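(* Let $k\ge 1$ be an integer. The space $M_k(\mathbb{R})$ of nondegenerate $2\times k\times(k+1)$ hypermatrices over $\mathbb{R}$ is homotopy equivalent to the disjoint union of two copies of $SO(k)\times SO(k+1)$.
   Context: A $2\times k\times(k+1)$ hypermatrix over a field $\mathbb{F}$ is an element of $\mathbb{F}^2\otimes\mathbb{F}^k\otimes\mathbb{F}^{k+1}$; it is written as a pair $(M_0,M_1)$ of $(k+1)\times k$ matrices over $\mathbb{F}$. It is degenerate (i.e. has zero hyperdeterminant) if there are nonzero vectors $x\in\overline{\mathbb{F}}^2$, $y\in\overline{\mathbb{F}}^k$, $z\in\overline{\mathbb{F}}^{k+1}$ at which the trilinear form $f(x,y,z)=\sum_{p,i,j}(M_p)_{ij}x_pz_iy_j$ and all its first partial derivatives vanish; for this format this is equivalent to the existence of nonzero $x\in\overline{\mathbb{F}}^2$, $y\in\overline{\mathbb{F}}^k$ with $(x_0M_0+x_1M_1)y=0$. Otherwise it is nondegenerate. (For $\mathbb{F}=\mathbb{R}$ the vectors range over $\overline{\mathbb{R}}=\mathbb{C}$.) $M_k(\mathbb{R})$ is the set of nondegenerate $2\times k\times(k+1)$ hypermatrices over $\mathbb{R}$, with the subspace topology from $\mathbb{R}^{2k(k+1)}$ (Euclidean topology). *)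

theory Defs
  imports "HOL-Analysis.Analysis"
begin

text \<open>
  A hypermatrix of format \<open>2 \<times> CARD('k) \<times> CARD('m)\<close> over a field is an element \<open>M\<close> of
  type \<open>'a^'k^'m^2\<close>: the slice \<open>M $ p\<close> (the matrix \<open>M\<^sub>p\<close>, with \<open>p\<close> in the two-element
  index type \<open>2\<close>) has rows indexed by \<open>'m\<close> and columns indexed by \<open>'k\<close>.
\<close>

definition trilinear_form ::
    "'a::comm_semiring_1^'k^'m^2 \<Rightarrow> 'a^2 \<Rightarrow> 'a^'k \<Rightarrow> 'a^'m \<Rightarrow> 'a" where
  "trilinear_form M x y z = (\<Sum>p\<in>UNIV. \<Sum>i\<in>UNIV. \<Sum>j\<in>UNIV. M $ p $ i $ j * x $ p * z $ i * y $ j)"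

definition complexify :: "real^'k^'m^2 \<Rightarrow> complex^'k^'m^2" where
  "complexify M = (\<chi> p i j. complex_of_real (M $ p $ i $ j))"

text \<open>
  The first partial derivatives are the derivatives at \<open>t = 0\<close> along the coordinate
  directions \<open>axis i 1\<close> in each of the three vector arguments.
\<close>

definition degenerate :: "real^'k^'m^2 \<Rightarrow> bool" where
  "degenerate M \<longleftrightarrow>
     (\<exists>(x :: complex^2) (y :: complex^'k) (z :: complex^'m).
        x \<noteq> 0 \<and> y \<noteq> 0 \<and> z \<noteq> 0 \<and>
        trilinear_form (complexify M) x y z = 0 \<and>
        (\<forall>p. ((\<lambda>t. trilinear_form (complexify M) (x + t *s axis p 1) y z)
                has_field_derivative 0) (at 0)) \<and>
        (\<forall>j. ((\<lambda>t. trilinear_form (complexify M) x (y + t *s axis j 1) z)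
                has_field_derivative 0) (at 0)) \<and>
        (\<forall>i. ((\<lambda>t. trilinear_form (complexify M) x y (z + t *s axis i 1))
                has_field_derivative 0) (at 0)))"

definition nondegenerate_hypermatrices :: "(real^'k^'m^2) set" where
  "nondegenerate_hypermatrices = {M. \<not> degenerate M}"

definition special_orthogonal :: "(real^'n^'n) set" where
  "special_orthogonal = {Q. rotation_matrix Q}"

end

theory Submission
  imports Defs "HOL-Computational_Algebra.Fundamental_Theorem_Algebra"
begin

text \<open>
  Write \<open>(A, B)\<close> for the two slices. Nondegeneracy means that the pencil \<open>s A + t B\<close> is injective
  for all complex \<open>(s, t) \<noteq> 0\<close> (\<open>nondegenerate_iff_regular_pencil\<close>). By Kronecker's theory there is
  only one such pencil of format \<open>(k + 1) \<times> k\<close> up to real changes of bases: the standard pencil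
  \<open>(L\<^sub>0, L\<^sub>1)\<close>, whose slices send the basis vector \<open>e\<^sub>j\<close> to \<open>f\<^sub>j\<close> and to \<open>f\<^sub>j\<^sub>+\<^sub>1\<close>. Its stabiliser in
  \<open>GL\<^sub>k \<times> GL\<^sub>k\<^sub>+\<^sub>1\<close> consists of the scalars, so the space in question is \<open>(GL\<^sub>k \<times> GL\<^sub>k\<^sub>+\<^sub>1) / \<real>\<^sup>*\<close>.

  The part of Kronecker's theory that is used has a short proof. If \<open>A Q = P L\<^sub>0\<close> and \<open>B Q = P L\<^sub>1\<close>,
  then the columns \<open>q\<^sub>0, \<dots>, q\<^sub>k\<^sub>-\<^sub>1\<close> of \<open>Q\<close> form a chain: \<open>B q\<^sub>j = A q\<^sub>j\<^sub>+\<^sub>1\<close>. Let \<open>D\<^sub>n\<close> be the space of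
  the vectors that start a chain with \<open>n\<close> steps. The codimension of \<open>D\<^sub>n\<^sub>+\<^sub>1\<close> in \<open>D\<^sub>n\<close> is at most
  one, because the ranges of \<open>A\<close> and \<open>B\<close> are hyperplanes. It is positive while \<open>D\<^sub>n \<noteq> 0\<close>: otherwise a
  nonzero vector starts an infinite chain, and a complex eigenvector of the shift along that chain
  is a kernel vector of some \<open>s A + t B\<close> (\<open>infinite_chain_trivial\<close>). Hence \<open>D\<^sub>n\<close> has dimension
  \<open>k - n\<close> (\<open>dim_chain_space\<close>). So \<open>D\<^sub>k\<^sub>-\<^sub>1\<close> is a line, which makes the pair \<open>(Q, P)\<close> exist and be
  unique up to scalars, and the strictly decreasing flag \<open>D\<^sub>0 \<supset> D\<^sub>1 \<supset> \<dots>\<close> makes \<open>Q\<close> and \<open>P\<close> invertible.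

  Exactly one of \<open>k\<close> and \<open>k + 1\<close> is odd, and the determinant of the matrix of that size changes its
  sign under \<open>-1\<close>. Requiring it to be positive selects one of the two pairs \<open>\<plusminus> (Q, P)\<close>, and what
  is left of the quotient is the action of the positive scalars, which does not affect the
  homotopy type (\<open>nondegenerate_homotopy_eqv_oriented_frames\<close>). Gram-Schmidt orthonormalisation of both
  matrices preserves the signs of the determinants along a straight homotopy, so it retracts this
  space of pairs onto the pairs of orthogonal matrices in which the odd-sized one has determinant
  \<open>1\<close> (\<open>oriented_frames_homotopy_eqv_orthogonal_frames\<close>). The other determinant is \<open>1\<close> or \<open>-1\<close>, and either
  value gives a copy of \<open>SO(k) \<times> SO(k + 1)\<close>.
\<close>

section \<open>Nondegeneracy as injectivity of a matrix pencil\<close>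

definition cmat :: "real^'k^'m \<Rightarrow> complex^'k^'m" where
  "cmat A = (\<chi> i j. complex_of_real (A $ i $ j))"

definition regular_pencil :: "real^'k^'m \<Rightarrow> real^'k^'m \<Rightarrow> bool" where
  "regular_pencil A B \<longleftrightarrow>
     (\<forall>s t y. s *s (cmat A *v y) + t *s (cmat B *v y) = 0 \<longrightarrow> y = 0 \<or> s = 0 \<and> t = 0)"

text \<open>
  Stated for matrices over any field; over \<open>\<complex>\<close> it provides the vector \<open>z\<close> of a degenerate triple
  and a linear relation among sufficiently many vectors.
\<close>

lemma nontrivial_kernel:
  fixes A :: "'a::field^'m^'k"
  assumes "CARD('k) < CARD('m)"
  obtains z where "z \<noteq> 0" "A *v z = 0"
proof -
  have "\<not> inj ((*v) A)"
  proof
    assume inj: "inj ((*v) A)"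
    have "CARD('m) = vec.dim ((*v) A ` UNIV)"
      using vec.dim_image_eq[OF matrix_vector_mul_linear_gen, of A UNIV] inj vec_dim_card
      by (metis vec.span_UNIV)
    also have "\<dots> \<le> CARD('k)"
      by (rule dim_subset_UNIV_cart_gen)
    finally show False using assms by simp
  qed
  then show ?thesis
    using that matrix_left_invertible_ker[of A] matrix_left_invertible_injective[of A] by blast
qed

lemma matrix_vector_mult_axis: "(A *v axis j (1::'a::comm_semiring_1)) $ i = A $ i $ j"
  by (simp add: matrix_vector_mult_def axis_def if_distrib[where f="(*) _"] cong: if_cong)

lemma trilinear_form_eq:
  fixes M :: "'a::comm_semiring_1^'k^'m^2"
  shows "trilinear_form M x y z =
    (\<Sum>i\<in>UNIV. z $ i * (x$1 *s (M$1 *v y) + x$2 *s (M$2 *v y)) $ i)"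
  unfolding trilinear_form_def sum_2
  by (simp add: matrix_vector_mult_def sum_distrib_left sum.distrib algebra_simps)

lemma trilinear_form_linear:
  fixes M :: "'a::comm_semiring_1^'k^'m^2"
  shows "trilinear_form M (x + t *s a) y z = trilinear_form M x y z + t * trilinear_form M a y z"
    and "trilinear_form M x (y + t *s b) z = trilinear_form M x y z + t * trilinear_form M x b z"
    and "trilinear_form M x y (z + t *s c) = trilinear_form M x y z + t * trilinear_form M x y c"
  unfolding trilinear_form_def
  by (simp_all add: sum_distrib_left sum.distrib algebra_simps)

lemma affine_derivative_zero_iff:
  "((\<lambda>t. a + t * b) has_field_derivative 0) (at (0::'a::real_normed_field)) \<longleftrightarrow> b = 0"
proof -
  have "((\<lambda>t. a + t * b) has_field_derivative b) (at 0)"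
    by (auto intro!: derivative_eq_intros)
  then show ?thesis
    using DERIV_unique by metis
qed

text \<open>
  The form is affine in each coordinate, so a partial derivative is the value of the form at the
  corresponding unit vector.
\<close>

lemma degenerate_iff_partials:
  fixes M :: "real^'k^'m^2"
  shows "degenerate M \<longleftrightarrow>
     (\<exists>(x :: complex^2) (y :: complex^'k) (z :: complex^'m).
        x \<noteq> 0 \<and> y \<noteq> 0 \<and> z \<noteq> 0 \<and>
        trilinear_form (complexify M) x y z = 0 \<and>
        (\<forall>p. trilinear_form (complexify M) (axis p 1) y z = 0) \<and>
        (\<forall>j. trilinear_form (complexify M) x (axis j 1) z = 0) \<and>
        (\<forall>i. trilinear_form (complexify M) x y (axis i 1) = 0))"
  unfolding degenerate_def trilinear_form_linear affine_derivative_zero_iff ..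

lemma complexify_slice: "complexify M $ p = cmat (M $ p)"
  by (simp add: complexify_def cmat_def vec_eq_iff)

text \<open>
  The derivatives in the directions of \<open>z\<close> give the kernel vector. Conversely, let \<open>y\<close> be in the
  kernel of the pencil at \<open>x\<close>. A vector \<open>z\<close> completes a degenerate triple if it is orthogonal to
  the images of \<open>y\<close> under both slices and to all columns of the pencil at \<open>x\<close>. The two images
  span at most a line, and the columns satisfy the linear relation \<open>y\<close>, so these are at most
  \<open>CARD('k) < CARD('m)\<close> independent conditions.
\<close>

lemma nondegenerate_iff_regular_pencil:
  fixes M :: "real^'k^'m^2"
  assumes card: "CARD('k) < CARD('m)"
  shows "\<not> degenerate M \<longleftrightarrow> regular_pencil (M$1) (M$2)"
proof -
  let ?M = "complexify M"
  let ?N = "\<lambda>(x::complex^2) y. x$1 *s (?M$1 *v y) + x$2 *s (?M$2 *v y)"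
  let ?dot = "\<lambda>z w. \<Sum>i\<in>UNIV. z $ i * w $ i"
  have "degenerate M \<longleftrightarrow> (\<exists>x y. x \<noteq> 0 \<and> y \<noteq> 0 \<and> ?N x y = 0)"
  proof
    assume "degenerate M"
    then obtain x :: "complex^2" and y :: "complex^'k" where "x \<noteq> 0" "y \<noteq> 0"
      and *: "\<And>i::'m. trilinear_form ?M x y (axis i 1) = 0"
      unfolding degenerate_iff_partials by blast
    have "?N x y $ i = 0" for i
      using *[of i] unfolding trilinear_form_eq
      by (simp add: axis_def if_distrib[where f="\<lambda>u. u * _"] cong: if_cong)
    then have "?N x y = 0"
      by (simp add: vec_eq_iff)
    with \<open>x \<noteq> 0\<close> \<open>y \<noteq> 0\<close> show "\<exists>x y. x \<noteq> 0 \<and> y \<noteq> 0 \<and> ?N x y = 0" by blast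
  next
    assume "\<exists>x y. x \<noteq> 0 \<and> y \<noteq> 0 \<and> ?N x y = 0"
    then obtain x y where x: "x \<noteq> 0" and y: "y \<noteq> 0" and N: "?N x y = 0" by blast
    \<comment> \<open>Since \<open>x\<close> is nonzero, both slices send \<open>y\<close> into one line.\<close>
    obtain v a b where v: "?M$1 *v y = a *s v" "?M$2 *v y = b *s v"
    proof (cases "x$1 = 0")
      case True
      with x have "x$2 \<noteq> 0"
        by (auto simp: vec_eq_iff forall_2)
      with True N have "?M$2 *v y = 0 *s (?M$1 *v y)"
        by (simp add: vec_eq_iff)
      then show ?thesis
        using that[of 1 "?M$1 *v y" 0] by simp
    next
      case False
      have "?M$1 *v y = (- x$2 / x$1) *s (?M$2 *v y)"
      proof -
        have "x$1 * (?M$1 *v y) $ i = x$1 * ((- x$2 / x$1) *s (?M$2 *v y)) $ i" for i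
          using N False by (simp add: vec_eq_iff eq_neg_iff_add_eq_0)
        with False show ?thesis
          unfolding vec_eq_iff by (metis mult_cancel_left)
      qed
      then show ?thesis
        using that[of "- x$2 / x$1" "?M$2 *v y" 1] by (simp only: vector_smult_lid)
    qed
    obtain j0 where j0: "y $ j0 \<noteq> 0"
      using y by (auto simp: vec_eq_iff)
    \<comment> \<open>Being orthogonal to the \<open>j0\<close>-th column is redundant, so its row can be used for \<open>v\<close>.\<close>
    obtain z where z: "z \<noteq> 0"
      "(\<chi> j. if j = j0 then v else ?N x (axis j 1)) *v z = 0"
      using nontrivial_kernel[OF card] by blast
    have zrow: "?dot z (if j = j0 then v else ?N x (axis j 1)) = 0" for j
      using arg_cong[OF z(2), of "\<lambda>u. u $ j"]
      by (simp add: matrix_vector_mult_def mult.commute)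
    have zv: "?dot z v = 0"
      using zrow[of j0] by simp
    have zcol: "?dot z (?N x (axis j 1)) = 0" if "j \<noteq> j0" for j
      using zrow[of j] that by simp
    have "trilinear_form ?M x y z = (\<Sum>j\<in>UNIV. y $ j * trilinear_form ?M x (axis j 1) z)"
    proof -
      have "?N x y $ i = (\<Sum>j\<in>UNIV. y $ j * ?N x (axis j 1) $ i)" for i
        by (simp only: vector_add_component vector_smult_component matrix_vector_mult_axis)
          (simp add: matrix_vector_mult_def sum_distrib_left sum.distrib algebra_simps)
      then show ?thesis
        unfolding trilinear_form_eq sum_distrib_left
        by (subst sum.swap) (simp add: sum_distrib_left mult_ac)
    qed
    also have "\<dots> = y $ j0 * trilinear_form ?M x (axis j0 1) z"
      by (subst sum.remove[of _ j0]) (auto simp: trilinear_form_eq zcol[simplified])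
    finally have "trilinear_form ?M x (axis j0 1) z = 0"
      using N j0 by (simp add: trilinear_form_eq)
    then have P2: "trilinear_form ?M x (axis j 1) z = 0" for j
      using zcol[of j] unfolding trilinear_form_eq by (cases "j = j0") simp_all
    have "?dot z (c *s v) = 0" for c
      using zv by (simp add: mult.left_commute flip: sum_distrib_left)
    then have P1: "\<forall>p. trilinear_form ?M (axis p 1) y z = 0"
      unfolding trilinear_form_eq forall_2 v by (simp add: axis_def)
    have "trilinear_form ?M x y z' = 0" for z'
      unfolding trilinear_form_eq N by simp
    with x y z(1) P1 P2 show "degenerate M"
      unfolding degenerate_iff_partials by blast
  qed
  also have "\<dots> \<longleftrightarrow> \<not> regular_pencil (M$1) (M$2)"
  proof -
    have "(\<exists>x::complex^2. x \<noteq> 0 \<and> P (x$1) (x$2)) \<longleftrightarrow> (\<exists>s t. (s \<noteq> 0 \<or> t \<noteq> 0) \<and> P s t)"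
      for P :: "complex \<Rightarrow> complex \<Rightarrow> bool"
    proof
      assume "\<exists>x::complex^2. x \<noteq> 0 \<and> P (x$1) (x$2)"
      then show "\<exists>s t. (s \<noteq> 0 \<or> t \<noteq> 0) \<and> P s t"
        by (auto simp: vec_eq_iff[where 'a=complex] forall_2)
    next
      assume "\<exists>s t. (s \<noteq> 0 \<or> t \<noteq> 0) \<and> P s t"
      then obtain s t where "s \<noteq> 0 \<or> t \<noteq> 0" "P s t" by blast
      then have "vector [s, t] \<noteq> (0::complex^2) \<and> P ((vector [s, t] :: complex^2) $ 1) ((vector [s, t] :: complex^2) $ 2)"
        by (simp add: vec_eq_iff forall_2)
      then show "\<exists>x::complex^2. x \<noteq> 0 \<and> P (x$1) (x$2)" by blast
    qed
    from this[of "\<lambda>s t. \<exists>y. y \<noteq> 0 \<and> s *s (?M$1 *v y) + t *s (?M$2 *v y) = 0"]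
    show ?thesis
      unfolding regular_pencil_def complexify_slice by blast
  qed
  finally show ?thesis by blast
qed

section \<open>Chains of a regular pencil\<close>

abbreviation cvec :: "real^'n \<Rightarrow> complex^'n" where
  "cvec v \<equiv> (\<chi> i. complex_of_real (v $ i))"

lemma cmat_mult_cvec: "cmat A *v cvec v = cvec (A *v v)"
  by (simp add: cmat_def matrix_vector_mult_def vec_eq_iff)

lemma matrix_vector_mult_lincomb:
  fixes A :: "'a::comm_semiring_1^'k^'m"
  shows "A *v (\<Sum>n\<in>S. c n *s f n) = (\<Sum>n\<in>S. c n *s (A *v f n))"
proof -
  have "A *v (a *s x) = a *s (A *v x)" for a x
    by (simp add: vec_eq_iff matrix_vector_mult_def sum_distrib_left mult.left_commute)
  then show ?thesis
    by (induction S rule: infinite_finite_induct) (simp_all add: matrix_vector_right_distrib)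
qed

text \<open>
  The index types carry no order, but chains and triangular matrices need one: \<open>idx\<close> and \<open>unidx\<close>
  are a fixed numbering of a finite type and its inverse.
\<close>

definition idx :: "'n::finite \<Rightarrow> nat" where
  "idx = to_nat_on UNIV"

definition unidx :: "nat \<Rightarrow> 'n::finite" where
  "unidx = from_nat_into UNIV"

lemma idx_less: "idx (i::'n::finite) < CARD('n)"
  using bij_betw_apply[OF to_nat_on_finite[of "UNIV::'n set"]] by (simp add: idx_def)

lemma unidx_idx [simp]: "unidx (idx i) = i"
  by (simp add: idx_def unidx_def countable_finite)

lemma idx_unidx [simp]: "n < CARD('n) \<Longrightarrow> idx (unidx n :: 'n::finite) = n"
proof -
  assume "n < CARD('n)"
  then have "n \<in> idx ` (UNIV::'n set)"
    using bij_betw_imp_surj_on[OF to_nat_on_finite[of "UNIV::'n set"]] by (simp add: idx_def)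
  then show ?thesis by auto
qed

lemma idx_eq_iff [simp]: "idx i = idx j \<longleftrightarrow> i = j"
  by (metis unidx_idx)

lemma sum_idx: "(\<Sum>i\<in>UNIV. f (idx (i::'n::finite))) = (\<Sum>n<CARD('n). f n)"
  using sum.reindex_bij_betw[OF to_nat_on_finite[of "UNIV::'n set"]] by (simp add: idx_def)

text \<open>
  Think of \<open>v\<close> as the orbit of \<open>v 0\<close> under a partial linear map \<open>S\<close> with \<open>B u = A (S u)\<close>. A
  polynomial \<open>p\<close> is applied to \<open>S\<close> at \<open>v 0\<close> by \<open>W p\<close>, the sum of the \<open>p\<^sub>n v\<^sub>n\<close>. By dimension some nonzero
  \<open>p\<close> has \<open>W p = 0\<close>. Splitting off a linear factor \<open>X - l\<close> from \<open>p\<close> leaves \<open>r\<close> of smaller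
  degree, and \<open>W p = 0\<close> says that \<open>S\<close> multiplies \<open>W r\<close> by \<open>l\<close>. So \<open>W r\<close> is in the kernel of
  \<open>B - l A\<close>, and it is zero by regularity. Repeating this ends with a nonzero constant polynomial, so \<open>v 0 = 0\<close>.
\<close>

lemma infinite_chain_trivial:
  fixes A B :: "real^'k^'m"
  assumes card: "CARD('k) < CARD('m)"
    and reg: "regular_pencil A B"
    and chain: "\<And>n. B *v v n = A *v v (Suc n)"
  shows "v 0 = 0"
proof (rule ccontr)
  assume v0: "v 0 \<noteq> 0"
  let ?N = "CARD('m)"
  define W where "W = (\<lambda>p. \<Sum>n<?N. coeff p n *s cvec (v n))"
  have W0: "W p \<noteq> 0" if "p \<noteq> 0" "degree p < ?N" for p
    using that
  proof (induction "degree p" arbitrary: p rule: less_induct)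
    case (less p)
    show ?case
    proof (cases "degree p = 0")
      case True
      then obtain c where c: "p = [:c:]" by (rule degree_eq_zeroE)
      have "?N > 0" by simp
      have "W p = coeff p 0 *s cvec (v 0)"
        unfolding W_def by (subst sum.remove[of _ 0]) (auto simp: c coeff_pCons intro!: sum.neutral split: nat.splits)
      then show ?thesis
        using v0 less.prems(1) c by (auto simp: vec_eq_iff)
    next
      case False
      then have "\<not> constant (poly p)"
        by (simp add: constant_degree)
      then obtain l where "poly p l = 0"
        using fundamental_theorem_of_algebra by blast
      then obtain r where r: "p = [:- l, 1:] * r"
        unfolding poly_eq_0_iff_dvd by (elim dvdE)
      with less.prems(1) have "r \<noteq> 0" by auto
      then have deg: "degree p = Suc (degree r)"
        unfolding r by (subst degree_mult_eq) auto
      have Wr: "W r \<noteq> 0"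
        using less.hyps[of r] less.prems(2) deg \<open>r \<noteq> 0\<close> by auto
      let ?S = "\<Sum>n<?N. coeff r n *s cvec (v (Suc n))"
      have top: "coeff r (?N - 1) = 0"
        using less.prems(2) deg by (intro coeff_eq_0) auto
      have N: "?N = Suc (?N - 1)"
        using zero_less_card_finite[where 'a='m] by linarith
      have "(\<Sum>n<?N. coeff (pCons 0 r) n *s cvec (v n)) = (\<Sum>n<?N - 1. coeff r n *s cvec (v (Suc n)))"
        by (subst N, subst sum.lessThan_Suc_shift) simp
      also have "\<dots> = (\<Sum>n<Suc (?N - 1). coeff r n *s cvec (v (Suc n)))"
        by (simp only: sum.lessThan_Suc top) simp
      also have "\<dots> = ?S"
        by (simp only: N[symmetric])
      finally have shift: "(\<Sum>n<?N. coeff (pCons 0 r) n *s cvec (v n)) = ?S" .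
      have "p = pCons 0 r - smult l r"
        by (simp add: r)
      then have "W p = ?S - l *s W r"
        unfolding shift[symmetric] W_def
        by (simp add: vector_sub_rdistrib sum_subtractf vec.scale_sum_right)
      moreover have "cmat B *v W r = cmat A *v ?S"
        unfolding W_def matrix_vector_mult_lincomb cmat_mult_cvec chain ..
      ultimately have "W p = 0 \<Longrightarrow> (- l) *s (cmat A *v W r) + 1 *s (cmat B *v W r) = 0"
        by (simp add: vector_scalar_commute)
      then show ?thesis
        using reg Wr unfolding regular_pencil_def by (metis zero_neq_one)
    qed
  qed
  obtain z :: "complex^'m" where z: "z \<noteq> 0" "(\<chi> (a::'k) i. cvec (v (idx i)) $ a) *v z = 0"
    using nontrivial_kernel[OF card] by blast
  define p where "p = Poly (map (\<lambda>n. z $ unidx n) [0..<?N])"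
  have co: "coeff p n = z $ unidx n" if "n < ?N" for n
    using that by (simp add: p_def nth_default_def)
  obtain i where "z $ i \<noteq> 0"
    using z(1) by (auto simp: vec_eq_iff)
  then have "coeff p (idx i) \<noteq> 0"
    by (simp add: co idx_less)
  then have "p \<noteq> 0" by auto
  moreover have "degree p < ?N"
    using coeff_eq_0
    by (rule_tac degree_lessI) (auto simp: p_def nth_default_def)
  moreover have "W p = 0"
  proof -
    have "W p = (\<Sum>n<?N. z $ unidx n *s cvec (v n))"
      unfolding W_def by (rule sum.cong) (auto simp: co)
    also have "\<dots> = (\<Sum>i\<in>UNIV. z $ unidx (idx (i::'m)) *s cvec (v (idx i)))"
      by (rule sum_idx[symmetric])
    also have "\<dots> = (\<chi> (a::'k) i. cvec (v (idx i)) $ a) *v z"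
      by (simp add: vec_eq_iff matrix_vector_mult_def mult.commute)
    finally show ?thesis using z(2) by simp
  qed
  ultimately show False using W0 by blast
qed

text \<open>
  The vectors \<open>v\<close> that start a chain of \<open>n\<close> steps.
\<close>

primrec chain_space :: "real^'k^'m \<Rightarrow> real^'k^'m \<Rightarrow> nat \<Rightarrow> (real^'k) set" where
  "chain_space A B 0 = UNIV"
| "chain_space A B (Suc n) = {v. \<exists>w\<in>chain_space A B n. B *v v = A *v w}"

lemma subspace_chain_space: "subspace (chain_space A B n)"
proof (induction n)
  case (Suc n)
  have "chain_space A B (Suc n) = (*v) B -` ((*v) A ` chain_space A B n)"
    by auto
  moreover have "subspace ((*v) B -` ((*v) A ` chain_space A B n))"
    by (intro linear_subspace_vimage linear_subspace_image matrix_vector_mul_linear Suc)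
  ultimately show ?case by simp
qed auto

lemma chain_space_decreasing: "m \<le> n \<Longrightarrow> chain_space A B n \<subseteq> chain_space A B m"
proof -
  have "chain_space A B (Suc n) \<subseteq> chain_space A B n" for n
    by (induction n) auto
  then show "m \<le> n \<Longrightarrow> chain_space A B n \<subseteq> chain_space A B m"
    by (rule lift_Suc_antimono_le)
qed

lemma regular_pencil_inj:
  assumes "regular_pencil A B"
  shows "A *v v = 0 \<Longrightarrow> v = 0" "B *v v = 0 \<Longrightarrow> v = 0"
proof -
  have cv: "cvec v = 0 \<Longrightarrow> v = 0"
    by (simp add: vec_eq_iff)
  have 0: "cvec 0 = 0"
    by (simp only: vec_eq_iff) simp
  show "v = 0" if "A *v v = 0"
    using assms[unfolded regular_pencil_def, rule_format, of 1 "cvec v" 0] cv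
    by (simp add: cmat_mult_cvec that 0 del: zero_index)
  show "v = 0" if "B *v v = 0"
    using assms[unfolded regular_pencil_def, rule_format, of 0 "cvec v" 1] cv
    by (simp add: cmat_mult_cvec that 0 del: zero_index)
qed

text \<open>
  The dimension drops by at most one per step because \<open>chain_space A B (Suc n)\<close> is the preimage
  under \<open>B\<close> of a subspace of dimension \<open>dim (chain_space A B n)\<close>, and the range of \<open>B\<close> has codimension one.
  If it did not drop, chains could be prolonged indefinitely inside \<open>chain_space A B n\<close>.
\<close>

lemma dim_chain_space:
  fixes A B :: "real^'k^'m"
  assumes card: "CARD('m) = CARD('k) + 1" and reg: "regular_pencil A B"
  shows "n \<le> CARD('k) \<Longrightarrow> dim (chain_space A B n) = CARD('k) - n"
proof (induction n)
  case (Suc n)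
  let ?D = "chain_space A B"
  have inj: "inj ((*v) A)" "inj ((*v) B)"
    using regular_pencil_inj[OF reg] by (auto simp: linear_injective_0)
  have "CARD('k) + dim (?D n) \<le> dim (range ((*v) B) \<inter> (*v) A ` ?D n) + CARD('m)"
  proof -
    have "dim {x + y |x y. x \<in> range ((*v) B) \<and> y \<in> (*v) A ` ?D n} \<le> CARD('m)"
      using dim_subset_UNIV_cart by blast
    moreover have "dim {x + y |x y. x \<in> range ((*v) B) \<and> y \<in> (*v) A ` ?D n}
        + dim (range ((*v) B) \<inter> (*v) A ` ?D n) = dim (range ((*v) B)) + dim ((*v) A ` ?D n)"
      by (intro dim_sums_Int linear_subspace_image matrix_vector_mul_linear subspace_UNIV
          subspace_chain_space)
    moreover have "dim (range ((*v) B)) = CARD('k)"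
      using inj(2) by (subst dim_image_eq) auto
    moreover have "dim ((*v) A ` ?D n) = dim (?D n)"
      using inj(1) by (subst dim_image_eq) (auto intro: inj_on_subset)
    ultimately show ?thesis by linarith
  qed
  also have "range ((*v) B) \<inter> (*v) A ` ?D n = (*v) B ` ?D (Suc n)"
    by auto
  also have "dim ((*v) B ` ?D (Suc n)) \<le> dim (?D (Suc n))"
    by (intro dim_image_le matrix_vector_mul_linear)
  finally have "dim (?D n) \<le> dim (?D (Suc n)) + 1"
    unfolding card by linarith
  moreover have "dim (?D (Suc n)) < dim (?D n)"
  proof (rule ccontr)
    assume "\<not> dim (?D (Suc n)) < dim (?D n)"
    then have eq: "?D (Suc n) = ?D n"
      by (intro subspace_dim_equal subspace_chain_space chain_space_decreasing) auto
    have "\<forall>v\<in>?D n. \<exists>w. w \<in> ?D n \<and> B *v v = A *v w"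
      using eq[symmetric] unfolding chain_space.simps by blast
    then obtain f where f: "\<And>v. v \<in> ?D n \<Longrightarrow> f v \<in> ?D n \<and> B *v v = A *v f v"
      using bchoice[of "?D n"] by meson
    have "v = 0" if "v \<in> ?D n" for v
    proof -
      have D: "(f ^^ j) v \<in> ?D n" for j
        using f that by (induction j) auto
      have "(f ^^ 0) v = 0"
        using card f[OF D] by (intro infinite_chain_trivial[OF _ reg]) auto
      then show ?thesis by simp
    qed
    then have "dim (?D n) = 0" by (auto simp: dim_eq_0)
    with Suc show False by simp
  qed
  ultimately show ?case
    using Suc by simp
qed simp

lemma chain_space_CARD:
  fixes A B :: "real^'k^'m"
  assumes "CARD('m) = CARD('k) + 1" and "regular_pencil A B"
  shows "chain_space A B (CARD('k)) = {0}"
proof -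
  have "dim (chain_space A B (CARD('k))) = 0"
    unfolding dim_chain_space[OF assms order_refl] by (rule diff_self_eq_0)
  then have "chain_space A B (CARD('k)) \<subseteq> {0}"
    unfolding dim_eq_0 .
  moreover have "0 \<in> chain_space A B (CARD('k))"
    by (rule subspace_0[OF subspace_chain_space])
  ultimately show ?thesis by blast
qed

definition is_chain :: "real^'k^'m \<Rightarrow> real^'k^'m \<Rightarrow> nat \<Rightarrow> (nat \<Rightarrow> real^'k) \<Rightarrow> bool" where
  "is_chain A B n q \<longleftrightarrow> (\<forall>j<n. B *v q j = A *v q (Suc j))"

lemma chain_space_imp_chain:
  "v \<in> chain_space A B n \<Longrightarrow> \<exists>q. q 0 = v \<and> is_chain A B n q"
proof (induction n arbitrary: v)
  case (Suc n)
  then obtain w where w: "B *v v = A *v w" "w \<in> chain_space A B n"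
    by auto
  then obtain q where "q 0 = w" "is_chain A B n q"
    using Suc.IH by blast
  with w have "is_chain A B (Suc n) (case_nat v q)"
    by (auto simp: is_chain_def less_Suc_eq_0_disj)
  then show ?case
    by (metis old.nat.simps(4))
qed (auto simp: is_chain_def)

lemma chain_in_chain_space:
  assumes "is_chain A B n q" "i \<le> n"
  shows "q (n - i) \<in> chain_space A B i"
  using assms(2)
proof (induction i)
  case (Suc i)
  then have "B *v q (n - Suc i) = A *v q (n - i)"
    using assms(1)[unfolded is_chain_def, rule_format, of "n - Suc i"] by (simp add: Suc_diff_Suc)
  with Suc show ?case by auto
qed simp

text \<open>
  A chain that starts at \<open>q j\<close> can be prolonged to the left by \<open>q 0, \<dots>, q (j - 1)\<close>.
\<close>

lemma chain_start_in_chain_space: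
  assumes "is_chain A B n q" "j \<le> n" "q j \<in> chain_space A B i"
  shows "q 0 \<in> chain_space A B (i + j)"
  using assms(2,3)
proof (induction j arbitrary: i)
  case (Suc j)
  then have "q j \<in> chain_space A B (Suc i)"
    using assms(1) by (auto simp: is_chain_def)
  with Suc.IH[of "Suc i"] Suc.prems show ?case by simp
qed simp

text \<open>
  If \<open>q j\<close> started a chain of \<open>CARD('k) - j\<close> steps, then \<open>q 0\<close> would start one of \<open>CARD('k)\<close> steps, which
  only the zero vector does.
\<close>

lemma chain_notin:
  fixes A B :: "real^'k^'m"
  assumes "CARD('m) = CARD('k) + 1" and "regular_pencil A B"
    and "is_chain A B (CARD('k) - 1) q" "q 0 \<noteq> 0" "j < CARD('k)"
  shows "q j \<notin> chain_space A B (CARD('k) - j)"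
proof
  assume "q j \<in> chain_space A B (CARD('k) - j)"
  then have "q 0 \<in> chain_space A B (CARD('k) - j + j)"
    using assms(5) by (intro chain_start_in_chain_space[OF assms(3)]) auto
  also have "CARD('k) - j + j = CARD('k)"
    using assms(5) by simp
  also have "chain_space A B \<dots> = {0}"
    by (rule chain_space_CARD[OF assms(1,2)])
  finally show False
    using assms(4) by simp
qed

text \<open>
  Of the vectors in a linear relation, the last one would lie in the chain space that contains all
  the earlier ones, against \<open>chain_notin\<close>.
\<close>

lemma chain_independent:
  fixes A B :: "real^'k^'m"
  assumes card: "CARD('m) = CARD('k) + 1" and reg: "regular_pencil A B"
    and chain: "is_chain A B (CARD('k) - 1) q" "q 0 \<noteq> 0"
    and "n \<le> CARD('k)" "(\<Sum>j<n. c j *\<^sub>R q j) = 0" "j < n"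
  shows "c j = 0"
  using assms(5-)
proof (induction n arbitrary: j)
  case (Suc n)
  let ?D = "chain_space A B (CARD('k) - n)"
  have "c n = 0"
  proof (rule ccontr)
    assume "c n \<noteq> 0"
    have "q i \<in> ?D" if "i < n" for i
    proof -
      have "q (CARD('k) - 1 - (CARD('k) - 1 - i)) \<in> chain_space A B (CARD('k) - 1 - i)"
        by (rule chain_in_chain_space[OF chain(1)]) simp
      moreover have "CARD('k) - 1 - (CARD('k) - 1 - i) = i"
        using that Suc.prems by simp
      ultimately show ?thesis
        using chain_space_decreasing[of "CARD('k) - n" "CARD('k) - 1 - i" A B] that Suc.prems(1)
        by (metis One_nat_def Suc_diff_Suc Suc_leI diff_diff_left diff_le_mono2 plus_1_eq_Suc subsetD)
    qed
    then have "(- 1 / c n) *\<^sub>R (\<Sum>i<n. c i *\<^sub>R q i) \<in> ?D"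
      by (intro subspace_scale subspace_sum subspace_chain_space) auto
    moreover have "(\<Sum>i<n. c i *\<^sub>R q i) = - (c n *\<^sub>R q n)"
      using Suc.prems(2) by (simp add: add_eq_0_iff2)
    ultimately have "q n \<in> ?D"
      using \<open>c n \<noteq> 0\<close> by simp
    then show False
      using chain_notin[OF card reg chain, of n] Suc.prems by simp
  qed
  with Suc show ?case by (auto simp: less_Suc_eq)
qed simp

lemma chain_exists:
  fixes A B :: "real^'k^'m"
  assumes "CARD('m) = CARD('k) + 1" and "regular_pencil A B"
  obtains q where "q 0 \<noteq> 0" "is_chain A B (CARD('k) - 1) q"
proof -
  have "dim (chain_space A B (CARD('k) - 1)) = 1"
    using dim_chain_space[OF assms, of "CARD('k) - 1"] by (simp add: Suc_leI)
  then obtain v where "v \<in> chain_space A B (CARD('k) - 1)" "v \<noteq> 0"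
    by (metis dim_eq_0 subset_singletonD zero_neq_one subsetI singleton_iff)
  then show ?thesis
    using that chain_space_imp_chain by metis
qed

lemma dim_one_proportional:
  fixes u v :: "'a::euclidean_space"
  assumes "subspace S" "dim S = 1" "u \<in> S" "u \<noteq> 0" "v \<in> S"
  obtains c where "v = c *\<^sub>R u"
proof -
  have "span {u} = S"
    using assms by (intro subspace_dim_equal span_minimal) (auto simp: dim_singleton)
  then show ?thesis
    using assms(5) that by (auto simp: span_singleton)
qed

text \<open>
  The first vectors of both chains lie in the last nonzero chain space, which is a line; injectivity
  of \<open>A\<close> carries the proportionality along the chains.
\<close>

lemma chain_unique:
  fixes A B :: "real^'k^'m"
  assumes card: "CARD('m) = CARD('k) + 1" and reg: "regular_pencil A B"
    and q: "is_chain A B (CARD('k) - 1) q" "q 0 \<noteq> 0" and q': "is_chain A B (CARD('k) - 1) q'"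
  obtains c where "\<And>j. j < CARD('k) \<Longrightarrow> q' j = c *\<^sub>R q j"
proof -
  have "q (CARD('k) - 1 - (CARD('k) - 1)) \<in> chain_space A B (CARD('k) - 1)"
    "q' (CARD('k) - 1 - (CARD('k) - 1)) \<in> chain_space A B (CARD('k) - 1)"
    by (intro chain_in_chain_space q q' order_refl)+
  moreover have "dim (chain_space A B (CARD('k) - 1)) = 1"
    using dim_chain_space[OF assms(1,2), of "CARD('k) - 1"] by (simp add: Suc_leI)
  ultimately obtain c where c: "q' 0 = c *\<^sub>R q 0"
    using dim_one_proportional[OF subspace_chain_space, of A B _ "q 0" "q' 0"] q(2) by auto
  have "q' j = c *\<^sub>R q j" if "j < CARD('k)" for j
    using that
  proof (induction j)
    case (Suc j)
    then have "j < CARD('k) - 1" by simp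
    then have "A *v (q' (Suc j) - c *\<^sub>R q (Suc j)) = B *v q' j - c *\<^sub>R (B *v q j)"
      using q(1) q' by (simp add: is_chain_def matrix_vector_mult_diff_distrib scaleR_matrix_vector_assoc
          matrix_vector_mult_scaleR)
    also have "\<dots> = 0"
      using Suc by (simp add: matrix_vector_mult_scaleR)
    finally show ?case
      using regular_pencil_inj(1)[OF reg] by fastforce
  qed (use c in simp)
  then show ?thesis using that by blast
qed

section \<open>Intertwiners with the standard pencil\<close>

text \<open>
  The slices of the standard pencil: column \<open>j\<close> is the unit vector in the place \<open>j\<close> and \<open>j + 1\<close>,
  respectively.
\<close>

definition std_low :: "real^'k^'m" where
  "std_low = (\<chi> i j. if idx i = idx j then 1 else 0)"

definition std_high :: "real^'k^'m" where
  "std_high = (\<chi> i j. if idx i = Suc (idx j) then 1 else 0)"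

definition intertwiners :: "real^'k^'m \<Rightarrow> real^'k^'m \<Rightarrow> ((real^'k^'k) \<times> (real^'m^'m)) set" where
  "intertwiners A B = {(Q, P). A ** Q = P ** std_low \<and> B ** Q = P ** std_high}"

abbreviation ncol :: "real^'n^'m \<Rightarrow> nat \<Rightarrow> real^'m" where
  "ncol A n \<equiv> column (unidx n) A"

lemma column_matrix_mult: "column j (A ** B) = A *v column j B"
  by (simp add: column_def matrix_matrix_mult_def matrix_vector_mult_def vec_eq_iff)

lemma matrix_eq_columns: "A = B \<longleftrightarrow> (\<forall>j. column j A = column j B)"
  by (auto simp: column_def vec_eq_iff)

lemma forall_idx: "(\<forall>i::'n::finite. R i) \<longleftrightarrow> (\<forall>n<CARD('n). R (unidx n))"
  by (metis idx_less unidx_idx)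

lemma column_mult_std:
  fixes P :: "real^'m^'m"
  assumes "n < CARD('k)" "CARD('m) = CARD('k) + 1"
  shows "ncol (P ** (std_low :: real^'k^'m)) n = ncol P n"
    and "ncol (P ** (std_high :: real^'k^'m)) n = ncol P (Suc n)"
proof -
  have *: "(idx i = m) = (i = unidx m)" if "m < CARD('m)" for m and i :: 'm
    using that by (metis idx_unidx unidx_idx)
  show "ncol (P ** (std_low :: real^'k^'m)) n = ncol P n"
    and "ncol (P ** (std_high :: real^'k^'m)) n = ncol P (Suc n)"
    using assms by (simp_all add: column_def matrix_matrix_mult_def vec_eq_iff std_low_def std_high_def *
        if_distrib[where f="(*) _"] cong: if_cong)
qed

text \<open>
  In terms of columns, a pair of intertwining matrices is a chain (the columns of \<open>Q\<close>) together
  with its images (the columns of \<open>P\<close>).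
\<close>

lemma intertwiners_iff:
  fixes A B :: "real^'k^'m"
  assumes "CARD('m) = CARD('k) + 1"
  shows "(Q, P) \<in> intertwiners A B \<longleftrightarrow>
    (\<forall>j<CARD('k). A *v ncol Q j = ncol P j \<and> B *v ncol Q j = ncol P (Suc j))"
  unfolding intertwiners_def matrix_eq_columns forall_idx
  using assms by (auto simp: column_matrix_mult[symmetric] column_mult_std)

lemma intertwiner_chain:
  fixes A B :: "real^'k^'m"
  assumes "CARD('m) = CARD('k) + 1" and "(Q, P) \<in> intertwiners A B"
  shows "is_chain A B (CARD('k) - 1) (ncol Q)"
  using assms(2) unfolding intertwiners_iff[OF assms(1)] is_chain_def by auto

lemma intertwiner_snd:
  fixes A B :: "real^'k^'m"
  assumes "CARD('m) = CARD('k) + 1" and "(Q, P) \<in> intertwiners A B" and "i < CARD('m)"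
  shows "ncol P i = (case i of 0 \<Rightarrow> A *v ncol Q 0 | Suc j \<Rightarrow> B *v ncol Q j)"
  using assms(2,3) unfolding intertwiners_iff[OF assms(1)] assms(1) by (auto split: nat.split)

lemma intertwiner_proportional:
  fixes A B :: "real^'k^'m"
  assumes card: "CARD('m) = CARD('k) + 1"
    and "(Q, P) \<in> intertwiners A B" "(Q', P') \<in> intertwiners A B"
    and *: "\<And>j. j < CARD('k) \<Longrightarrow> ncol Q' j = c *\<^sub>R ncol Q j"
  shows "(Q', P') = c *\<^sub>R (Q, P)"
proof -
  have sc: "column j (c *\<^sub>R A) = c *\<^sub>R column j A" for j and A :: "real^'a^'b"
    by (simp add: column_def vec_eq_iff)
  have "Q' = c *\<^sub>R Q"
    unfolding matrix_eq_columns forall_idx sc using * by blast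
  moreover have "P' = c *\<^sub>R P"
    unfolding matrix_eq_columns forall_idx sc
  proof (intro allI impI)
    fix i assume i: "i < CARD('m)"
    show "ncol P' i = c *\<^sub>R ncol P i"
      unfolding intertwiner_snd[OF card assms(2) i] intertwiner_snd[OF card assms(3) i]
      using i card by (auto simp: * matrix_vector_mult_scaleR split: nat.split)
  qed
  ultimately show ?thesis by simp
qed

lemma intertwiner_start_nonzero:
  fixes A B :: "real^'k^'m"
  assumes card: "CARD('m) = CARD('k) + 1" and reg: "regular_pencil A B"
    and "(Q, P) \<in> intertwiners A B" "(Q, P) \<noteq> 0"
  shows "ncol Q 0 \<noteq> 0"
proof
  assume 0: "ncol Q 0 = 0"
  have "ncol Q j = 0" if "j < CARD('k)" for j
    using that
  proof (induction j)
    case (Suc j)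
    then have "j < CARD('k) - 1" by simp
    then have "A *v ncol Q (Suc j) = B *v ncol Q j"
      using intertwiner_chain[OF card assms(3)] unfolding is_chain_def by metis
    then show ?case
      using Suc regular_pencil_inj(1)[OF reg] by simp
  qed (rule 0)
  then have "(Q, P) = 0 *\<^sub>R (Q, P)"
    by (intro intertwiner_proportional[OF card assms(3,3)]) simp
  with assms(4) show False by (simp add: zero_prod_def)
qed

lemma intertwiner_exists:
  fixes A B :: "real^'k^'m"
  assumes card: "CARD('m) = CARD('k) + 1" and reg: "regular_pencil A B"
  obtains v where "v \<in> intertwiners A B" "v \<noteq> 0"
proof -
  obtain q where q: "q 0 \<noteq> 0" "is_chain A B (CARD('k) - 1) q"
    using chain_exists[OF assms] by blast
  define Q :: "real^'k^'k" where "Q = (\<chi> a j. q (idx j) $ a)"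
  define P :: "real^'m^'m"
    where "P = (\<chi> a i. (case idx i of 0 \<Rightarrow> A *v q 0 | Suc j \<Rightarrow> B *v q j) $ a)"
  have Q: "ncol Q j = q j" if "j < CARD('k)" for j
    using that by (simp add: Q_def column_def vec_eq_iff)
  have P: "ncol P i = (case i of 0 \<Rightarrow> A *v q 0 | Suc j \<Rightarrow> B *v q j)" if "i < CARD('m)" for i
    using that by (simp add: P_def column_def vec_eq_iff)
  have "(Q, P) \<in> intertwiners A B"
    unfolding intertwiners_iff[OF card]
  proof (intro allI impI)
    fix j assume j: "j < CARD('k)"
    then show "A *v ncol Q j = ncol P j \<and> B *v ncol Q j = ncol P (Suc j)"
      using q(2) card by (auto simp: Q P is_chain_def split: nat.split)
  qed
  moreover have "(Q, P) \<noteq> 0"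
  proof
    assume "(Q, P) = 0"
    then have "ncol Q 0 = 0"
      by (simp add: zero_prod_def column_def vec_eq_iff)
    with q(1) Q show False by simp
  qed
  ultimately show ?thesis using that by blast
qed

lemma intertwiner_unique:
  fixes A B :: "real^'k^'m"
  assumes card: "CARD('m) = CARD('k) + 1" and reg: "regular_pencil A B"
    and v: "v \<in> intertwiners A B" "v \<noteq> 0" and w: "w \<in> intertwiners A B"
  obtains c where "w = c *\<^sub>R v"
proof (cases v, cases w)
  fix Q P Q' P' assume vw: "v = (Q, P)" "w = (Q', P')"
  obtain c where "\<And>j. j < CARD('k) \<Longrightarrow> ncol Q' j = c *\<^sub>R ncol Q j"
    using chain_unique[OF card reg] intertwiner_chain[OF card] intertwiner_start_nonzero[OF card reg]
      v w vw by metis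
  then have "w = c *\<^sub>R v"
    using intertwiner_proportional[OF card] v w unfolding vw by blast
  then show ?thesis by (rule that)
qed

lemma det_nonzero_iff_kernel:
  fixes A :: "'a::field^'n^'n"
  shows "det A \<noteq> 0 \<longleftrightarrow> (\<forall>x. A *v x = 0 \<longrightarrow> x = 0)"
  by (metis invertible_det_nz invertible_left_inverse matrix_left_invertible_ker)

lemma matrix_vector_mult_ncol:
  fixes A :: "real^'n^'m"
  shows "A *v x = (\<Sum>n<CARD('n). x $ unidx n *\<^sub>R ncol A n)"
  using sum_idx[where 'n='n and f="\<lambda>n. x $ unidx n *\<^sub>R ncol A n"]
  by (simp add: matrix_mult_sum scalar_mult_eq_scaleR)

text \<open>
  \<open>Q\<close> is invertible since chains are independent. All columns of \<open>P\<close> but the last are the images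
  of those of \<open>Q\<close> under the injective \<open>A\<close>. The last one is not in the range of \<open>A\<close>, since this would
  prolong the chain.
\<close>

lemma intertwiner_invertible:
  fixes A B :: "real^'k^'m"
  assumes card: "CARD('m) = CARD('k) + 1" and reg: "regular_pencil A B"
    and QP: "(Q, P) \<in> intertwiners A B" "(Q, P) \<noteq> 0"
  shows "det Q \<noteq> 0" "det P \<noteq> 0"
proof -
  note chain = intertwiner_chain[OF card QP(1)] intertwiner_start_nonzero[OF card reg QP]
  have indep: "c j = 0" if "(\<Sum>j<CARD('k). c j *\<^sub>R ncol Q j) = 0" "j < CARD('k)" for c j
    using chain_independent[OF card reg chain order_refl that] .
  have "x = 0" if "Q *v x = 0" for x
    using indep[of "\<lambda>j. x $ unidx j"] that
    unfolding matrix_vector_mult_ncol vec_eq_iff forall_idx by simp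
  then show "det Q \<noteq> 0"
    by (simp add: det_nonzero_iff_kernel)
  have "z = 0" if "P *v z = 0" for z
  proof -
    let ?k = "CARD('k)"
    let ?s = "\<Sum>j<?k. z $ unidx j *\<^sub>R ncol Q j"
    let ?t = "z $ unidx ?k"
    have "0 = (\<Sum>j<?k. z $ unidx j *\<^sub>R ncol P j) + ?t *\<^sub>R ncol P ?k"
      using that unfolding matrix_vector_mult_ncol card by simp
    also have "(\<Sum>j<?k. z $ unidx j *\<^sub>R ncol P j) = (\<Sum>j<?k. A *v (z $ unidx j *\<^sub>R ncol Q j))"
      using QP(1) by (intro sum.cong) (auto simp: intertwiners_iff[OF card] matrix_vector_mult_scaleR)
    also have "\<dots> = A *v ?s"
      by (simp add: linear_sum[OF matrix_vector_mul_linear])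
    also have "ncol P ?k = B *v ncol Q (?k - 1)"
      using QP(1)[unfolded intertwiners_iff[OF card], rule_format, of "?k - 1"] by simp
    finally have 0: "A *v ?s + ?t *\<^sub>R (B *v ncol Q (?k - 1)) = 0" by simp
    have t: "?t = 0"
    proof (rule ccontr)
      assume "?t \<noteq> 0"
      have "A *v ((- 1 / ?t) *\<^sub>R ?s) = (- 1 / ?t) *\<^sub>R (A *v ?s)"
        by (rule matrix_vector_mult_scaleR)
      also have "A *v ?s = - (?t *\<^sub>R (B *v ncol Q (?k - 1)))"
        using 0 by (simp add: add_eq_0_iff2)
      also have "(- 1 / ?t) *\<^sub>R \<dots> = B *v ncol Q (?k - 1)"
        using \<open>?t \<noteq> 0\<close> by simp
      finally have "ncol Q (?k - 1) \<in> chain_space A B (Suc 0)"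
        by (auto intro: sym)
      moreover have "?k - (?k - 1) = Suc 0"
        using zero_less_card_finite[where 'a='k] by linarith
      ultimately show False
        using chain_notin[OF card reg chain, of "?k - 1"] by simp
    qed
    then have "?s = 0"
      using 0 regular_pencil_inj(1)[OF reg, of ?s] by simp
    then have "z $ unidx j = 0" if "j < ?k" for j
      using indep[of "\<lambda>j. z $ unidx j"] that by blast
    with t show "z = 0"
      unfolding vec_eq_iff forall_idx card by (simp add: less_Suc_eq)
  qed
  then show "det P \<noteq> 0"
    by (simp add: det_nonzero_iff_kernel)
qed

section \<open>The nondegenerate hypermatrices as a space of frames\<close>

lemma cmat_mult: "cmat (A ** B) = cmat A ** cmat B"
  by (simp add: cmat_def matrix_matrix_mult_def vec_eq_iff)

lemma cmat_one: "cmat (mat 1) = mat 1"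
  by (simp add: cmat_def mat_def vec_eq_iff)

lemma regular_pencil_equivalence:
  fixes P :: "real^'m^'m" and R :: "real^'k^'k"
  assumes "regular_pencil A B" "invertible P" "invertible R"
  shows "regular_pencil (P ** A ** R) (P ** B ** R)"
  unfolding regular_pencil_def
proof (intro allI impI)
  fix s t y
  obtain P' where "P' ** P = mat 1"
    using assms(2) unfolding invertible_def by blast
  then have P': "cmat P' ** cmat P = mat 1"
    by (metis cmat_mult cmat_one)
  obtain R' where "R' ** R = mat 1"
    using assms(3) unfolding invertible_def by blast
  then have R': "cmat R' ** cmat R = mat 1"
    by (metis cmat_mult cmat_one)
  assume "s *s (cmat (P ** A ** R) *v y) + t *s (cmat (P ** B ** R) *v y) = 0"
  then have 0: "cmat P *v (s *s (cmat A *v (cmat R *v y)) + t *s (cmat B *v (cmat R *v y))) = 0"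
    by (simp add: cmat_mult matrix_vector_right_distrib vector_scalar_commute
        matrix_vector_mul_assoc[symmetric])
  have "(cmat P' ** cmat P) *v (s *s (cmat A *v (cmat R *v y)) + t *s (cmat B *v (cmat R *v y))) = 0"
    unfolding matrix_vector_mul_assoc[symmetric] 0 by simp
  then have "cmat R *v y = 0 \<or> s = 0 \<and> t = 0"
    using assms(1) unfolding P' regular_pencil_def by simp
  moreover have "y = 0" if "cmat R *v y = 0"
  proof -
    have "(cmat R' ** cmat R) *v y = 0"
      unfolding matrix_vector_mul_assoc[symmetric] that by simp
    then show ?thesis unfolding R' by simp
  qed
  ultimately show "y = 0 \<or> s = 0 \<and> t = 0" by blast
qed

text \<open>
  Row \<open>n\<close> of the equation reads \<open>s y\<^sub>n + t y\<^sub>n\<^sub>-\<^sub>1 = 0\<close>; for \<open>s \<noteq> 0\<close> the coordinates vanish one after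
  the other, starting with the first.
\<close>

lemma regular_pencil_std:
  assumes card: "CARD('m) = CARD('k) + 1"
  shows "regular_pencil (std_low :: real^'k^'m) std_high"
  unfolding regular_pencil_def
proof (intro allI impI)
  fix s t :: complex and y :: "complex^'k"
  assume eq: "s *s (cmat (std_low :: real^'k^'m) *v y) + t *s (cmat (std_high :: real^'k^'m) *v y) = 0"
  have *: "(n = idx j) = (j = unidx n)" if "n < CARD('k)" for n and j :: 'k
    using that by (metis idx_unidx unidx_idx)
  have low: "(cmat (std_low :: real^'k^'m) *v y) $ unidx n = y $ unidx n" if "n < CARD('k)" for n
    using that card
    by (simp add: cmat_def std_low_def matrix_vector_mult_def * if_distrib[where f="\<lambda>x. x * _"]
        if_distrib[where f=complex_of_real] cong: if_cong)
  have high: "(cmat (std_high :: real^'k^'m) *v y) $ unidx (Suc n) = y $ unidx n" if "n < CARD('k)" for n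
    using that card
    by (simp add: cmat_def std_high_def matrix_vector_mult_def * if_distrib[where f="\<lambda>x. x * _"]
        if_distrib[where f=complex_of_real] cong: if_cong)
  have high0: "(cmat (std_high :: real^'k^'m) *v y) $ unidx 0 = 0"
    using card
    by (simp add: cmat_def std_high_def matrix_vector_mult_def)
  have row: "s * (cmat (std_low :: real^'k^'m) *v y) $ i + t * (cmat (std_high :: real^'k^'m) *v y) $ i = 0" for i
    using eq by (simp add: vec_eq_iff)
  have "y $ unidx n = 0" if "s \<noteq> 0" "n < CARD('k)" for n
    using that(2)
  proof (induction n)
    case 0
    then show ?case
      using row[of "unidx 0"] low high0 \<open>s \<noteq> 0\<close> by simp
  next
    case (Suc n)
    then show ?case
      using row[of "unidx (Suc n)"] low[of "Suc n"] high[of n] \<open>s \<noteq> 0\<close> by simp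
  qed
  moreover have "y $ unidx n = 0" if "s = 0" "t \<noteq> 0" "n < CARD('k)" for n
    using row[of "unidx (Suc n)"] high[of n] that by simp
  ultimately show "y = 0 \<or> s = 0 \<and> t = 0"
    unfolding vec_eq_iff forall_idx[where 'n='k] by auto
qed

text \<open>
  The action of base changes on the standard pencil.
\<close>

definition std_orbit_map :: "(real^'k^'k) \<times> (real^'m^'m) \<Rightarrow> real^'k^'m^2" where
  "std_orbit_map = (\<lambda>(Q, P). \<chi> p. P ** (if p = 1 then std_low else std_high) ** matrix_inv Q)"

lemma matrix_inv_mult:
  fixes Q :: "'a::field^'n^'n"
  assumes "det Q \<noteq> 0"
  shows "Q ** matrix_inv Q = mat 1" "matrix_inv Q ** Q = mat 1"
proof -
  have "\<exists>A. Q ** A = mat 1 \<and> A ** Q = mat 1"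
    using assms by (simp add: invertible_det_nz[symmetric] invertible_def)
  then have "Q ** matrix_inv Q = mat 1 \<and> matrix_inv Q ** Q = mat 1"
    unfolding matrix_inv_def by (rule someI_ex)
  then show "Q ** matrix_inv Q = mat 1" "matrix_inv Q ** Q = mat 1" by auto
qed

lemma matrix_inv_cancel:
  fixes Q :: "real^'k^'k"
  assumes "det Q \<noteq> 0"
  shows "A ** Q ** matrix_inv Q = A" "A ** matrix_inv Q ** Q = A"
  by (simp_all add: matrix_mul_assoc[symmetric] matrix_inv_mult[OF assms])

text \<open>
  For invertible \<open>Q\<close>, the nonlinear equation \<open>M = P L Q\<inverse>\<close> is the linear system that defines the
  intertwiners.
\<close>

lemma std_orbit_map_eq_iff:
  fixes Q :: "real^'k^'k"
  assumes "det Q \<noteq> 0"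
  shows "std_orbit_map (Q, P) = M \<longleftrightarrow> (Q, P) \<in> intertwiners (M$1) (M$2)"
proof -
  have "P ** L ** matrix_inv Q = A \<longleftrightarrow> A ** Q = P ** L" for L A
    using matrix_inv_cancel[OF assms] by metis
  then show ?thesis
    by (simp add: std_orbit_map_def intertwiners_def vec_eq_iff[of _ M] forall_2)
qed

lemma std_orbit_map_nondegenerate:
  fixes Q :: "real^'k^'k" and P :: "real^'m^'m"
  assumes "CARD('m) = CARD('k) + 1" "det Q \<noteq> 0" "det P \<noteq> 0"
  shows "std_orbit_map (Q, P) \<in> nondegenerate_hypermatrices"
proof -
  have inv: "invertible P" "invertible (matrix_inv Q)"
    using assms(2,3) matrix_inv_mult[OF assms(2)] by (auto simp: invertible_det_nz[symmetric] invertible_def)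
  have "regular_pencil (std_orbit_map (Q, P) $ 1) (std_orbit_map (Q, P) $ 2)"
    using regular_pencil_equivalence[OF regular_pencil_std[OF assms(1)] inv]
    by (simp add: std_orbit_map_def)
  then show ?thesis
    using assms(1) by (simp add: nondegenerate_hypermatrices_def nondegenerate_iff_regular_pencil)
qed

text \<open>
  The determinant of the matrix of odd size if \<open>CARD('m) = CARD('k) + 1\<close>; the parity makes it an odd
  function of the pair, so its sign distinguishes \<open>v\<close> from \<open>- v\<close>.
\<close>

definition orientation :: "(real^'k^'k) \<times> (real^'m^'m) \<Rightarrow> real" where
  "orientation v = (if odd CARD('k) then det (fst v) else det (snd v))"

definition oriented_frames :: "((real^'k^'k) \<times> (real^'m^'m)) set" where
  "oriented_frames = {v. det (fst v) \<noteq> 0 \<and> det (snd v) \<noteq> 0 \<and> 0 < orientation v}"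

lemma det_scaleR: "det (c *\<^sub>R A) = c ^ CARD('n) * det (A :: real^'n^'n)"
  using det_rows_mul[of "\<lambda>_. c" "\<lambda>i. A $ i"]
  by (simp add: scaleR_vec_def scalar_mult_eq_scaleR)

lemma det_zero_matrix: "det (0 :: real^'n^'n) = 0"
  using det_scaleR[of 0 "0 :: real^'n^'n"] by (simp add: power_0_left)

lemma orientation_minus:
  fixes v :: "(real^'k^'k) \<times> (real^'m^'m)"
  assumes "CARD('m) = CARD('k) + 1"
  shows "orientation (- v) = - orientation v"
  using det_scaleR[of "-1" "fst v"] det_scaleR[of "-1" "snd v"] assms
  by (simp add: orientation_def)

lemma oriented_frames_scaleR:
  "v \<in> oriented_frames \<Longrightarrow> 0 < c \<Longrightarrow> c *\<^sub>R v \<in> oriented_frames"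
  by (auto simp: oriented_frames_def orientation_def det_scaleR zero_less_mult_iff)

lemma continuous_on_matrix_mult [continuous_intros]:
  fixes f :: "'a::topological_space \<Rightarrow> real^'n^'m"
  assumes "continuous_on S f" "continuous_on S g"
  shows "continuous_on S (\<lambda>x. f x ** g x)"
  unfolding matrix_matrix_mult_def using assms
  by (intro continuous_intros continuous_on_vec_lambda) auto

lemma continuous_on_det [continuous_intros]:
  fixes f :: "'a::topological_space \<Rightarrow> real^'n^'n"
  assumes "continuous_on S f"
  shows "continuous_on S (\<lambda>x. det (f x))"
  unfolding det_def using assms
  by (intro continuous_intros continuous_on_vec_lambda) auto

lemma continuous_on_matrix_inv:
  fixes f :: "'a::topological_space \<Rightarrow> real^'n^'n"
  assumes "continuous_on S f" and nz: "\<And>x. x \<in> S \<Longrightarrow> det (f x) \<noteq> 0"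
  shows "continuous_on S (\<lambda>x. matrix_inv (f x))"
proof -
  \<comment> \<open>Cramer's rule for the columns of the inverse.\<close>
  let ?g = "\<lambda>x. \<chi> k j. det (\<chi> i l. if l = k then axis j 1 $ i else f x $ i $ l) / det (f x)"
  have "matrix_inv (f x) = ?g x" if "x \<in> S" for x
  proof -
    have "f x *v (matrix_inv (f x) *v axis j 1) = axis j 1" for j
      using nz[OF that] by (simp add: matrix_vector_mul_assoc matrix_inv_mult)
    then have "matrix_inv (f x) *v axis j 1 =
        (\<chi> k. det (\<chi> i l. if l = k then axis j 1 $ i else f x $ i $ l) / det (f x))" for j
      by (rule iffD1[OF cramer[OF nz[OF that]]])
    then show ?thesis
      by (simp add: vec_eq_iff matrix_vector_mult_axis)
  qed
  moreover have "continuous_on S (\<lambda>x. if l = k then axis j 1 $ i else f x $ i $ l)" for i j k l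
    using assms(1) by (cases "l = k") (auto intro!: continuous_intros)
  then have "continuous_on S ?g"
    using assms by (intro continuous_intros continuous_on_vec_lambda) auto
  ultimately show ?thesis
    by (simp cong: continuous_on_cong)
qed

lemma continuous_on_orientation: "continuous_on S orientation"
  unfolding orientation_def by (cases "odd CARD('a)") (auto intro!: continuous_intros)

text \<open>
  The intertwiners of a nondegenerate hypermatrix form a line; the norm and the orientation
  single out one of its points. The weak inequality makes the condition closed, which is what
  the proof of continuity needs.
\<close>

definition unit_frame :: "real^'k^'m^2 \<Rightarrow> (real^'k^'k) \<times> (real^'m^'m)" where
  "unit_frame M = (SOME v. v \<in> intertwiners (M$1) (M$2) \<and> norm v = 1 \<and> 0 \<le> orientation v)"

lemma matrix_mult_scaleR:
  fixes A :: "real^'n^'m" and B :: "real^'l^'n"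
  shows "A ** (c *\<^sub>R B) = c *\<^sub>R (A ** B)" "(c *\<^sub>R A) ** B = c *\<^sub>R (A ** B)"
  by (simp_all add: matrix_matrix_mult_def vec_eq_iff sum_distrib_left mult_ac)

lemma scaled_intertwiner: "v \<in> intertwiners A B \<Longrightarrow> c *\<^sub>R v \<in> intertwiners A B"
  by (auto simp: intertwiners_def matrix_mult_scaleR)

context
  assumes card: "CARD('m::finite) = CARD('k::finite) + 1"
begin

lemma nondegenerate_imp_regular:
  fixes M :: "real^'k^'m^2"
  shows "M \<in> nondegenerate_hypermatrices \<Longrightarrow> regular_pencil (M$1) (M$2)"
  using card by (simp add: nondegenerate_hypermatrices_def nondegenerate_iff_regular_pencil)

lemma intertwiner_orientation_nonzero:
  fixes M :: "real^'k^'m^2"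
  assumes "M \<in> nondegenerate_hypermatrices" "v \<in> intertwiners (M$1) (M$2)" "v \<noteq> 0"
  shows "det (fst v) \<noteq> 0" "det (snd v) \<noteq> 0" "orientation v \<noteq> 0"
  using intertwiner_invertible[OF card nondegenerate_imp_regular[OF assms(1)], of "fst v" "snd v"]
    assms(2,3) by (auto simp: orientation_def)

lemma unit_frame:
  fixes M :: "real^'k^'m^2"
  assumes M: "M \<in> nondegenerate_hypermatrices"
  shows "unit_frame M \<in> intertwiners (M$1) (M$2)" "norm (unit_frame M) = 1"
    "unit_frame M \<in> oriented_frames"
proof -
  obtain v where v: "v \<in> intertwiners (M$1) (M$2)" "v \<noteq> 0"
    using intertwiner_exists[OF card nondegenerate_imp_regular[OF M]] by blast
  let ?u = "(if 0 \<le> orientation v then 1 / norm v else - (1 / norm v)) *\<^sub>R v"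
  have "?u \<in> intertwiners (M$1) (M$2)"
    by (rule scaled_intertwiner[OF v(1)])
  moreover have "norm ?u = 1"
    using v(2) by simp
  moreover have "0 \<le> orientation ?u"
  proof (cases "0 \<le> orientation v")
    case True
    then show ?thesis by (auto simp: orientation_def det_scaleR)
  next
    case False
    then have "0 \<le> orientation (- v)"
      by (simp add: orientation_minus[OF card])
    then have "0 \<le> orientation ((1 / norm v) *\<^sub>R (- v))"
      unfolding orientation_def fst_scaleR snd_scaleR det_scaleR by (auto split: if_splits)
    with False show ?thesis by simp
  qed
  ultimately have *: "unit_frame M \<in> intertwiners (M$1) (M$2) \<and> norm (unit_frame M) = 1
      \<and> 0 \<le> orientation (unit_frame M)"
    unfolding unit_frame_def by (rule_tac someI[of _ ?u]) blast
  then show "unit_frame M \<in> intertwiners (M$1) (M$2)" "norm (unit_frame M) = 1" by auto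
  then have "unit_frame M \<noteq> 0" by auto
  from intertwiner_orientation_nonzero[OF M _ this] * show "unit_frame M \<in> oriented_frames"
    by (auto simp: oriented_frames_def)
qed

lemma unit_frame_unique:
  fixes M :: "real^'k^'m^2"
  assumes M: "M \<in> nondegenerate_hypermatrices"
    and v: "v \<in> intertwiners (M$1) (M$2)" "v \<noteq> 0" "0 \<le> orientation v"
  shows "v = norm v *\<^sub>R unit_frame M"
proof -
  note u = unit_frame[OF M]
  have "unit_frame M \<noteq> 0" using u(2) by auto
  then obtain c where c: "v = c *\<^sub>R unit_frame M"
    using intertwiner_unique[OF card nondegenerate_imp_regular[OF M] u(1) _ v(1)] by blast
  have "0 \<le> c"
  proof (rule ccontr)
    assume "\<not> 0 \<le> c"
    then have "(- c) *\<^sub>R unit_frame M \<in> oriented_frames"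
      using oriented_frames_scaleR[OF u(3), of "- c"] by simp
    then have "0 < orientation (- v)"
      by (simp add: c oriented_frames_def)
    then show False
      using v(3) by (simp add: orientation_minus[OF card])
  qed
  with c u(2) show ?thesis by simp
qed

text \<open>
  The graph is cut out by closed conditions, and the values lie in the compact unit sphere.
\<close>

lemma continuous_on_unit_frame:
  "continuous_on (nondegenerate_hypermatrices :: (real^'k^'m^2) set) unit_frame"
proof -
  let ?X = "nondegenerate_hypermatrices :: (real^'k^'m^2) set"
  let ?T = "sphere 0 1 :: ((real^'k^'k) \<times> (real^'m^'m)) set"
  let ?C = "{Mv::(real^'k^'m^2) \<times> ((real^'k^'k) \<times> (real^'m^'m)). fst Mv $ 1 ** fst (snd Mv) = snd (snd Mv) ** (std_low :: real^'k^'m)} \<inter>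
    {Mv. fst Mv $ 2 ** fst (snd Mv) = snd (snd Mv) ** (std_high :: real^'k^'m)} \<inter>
    {Mv. 0 \<le> orientation (snd Mv)}"
  have C: "closed ?C"
    by (intro closed_Int closed_Collect_eq closed_Collect_le continuous_intros
        continuous_on_compose2[OF continuous_on_orientation[of UNIV]]) auto
  have graph: "(\<lambda>M. (M, unit_frame M)) ` ?X = (?X \<times> ?T) \<inter> ?C"
  proof (intro equalityI subsetI)
    fix Mv assume "Mv \<in> (\<lambda>M. (M, unit_frame M)) ` ?X"
    then show "Mv \<in> (?X \<times> ?T) \<inter> ?C"
      using unit_frame by (auto simp: intertwiners_def oriented_frames_def split_beta less_imp_le)
  next
    fix Mv assume Mv: "Mv \<in> (?X \<times> ?T) \<inter> ?C"
    obtain M v where "Mv = (M, v)" by (rule prod.exhaust)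
    with Mv unit_frame_unique[of M v] show "Mv \<in> (\<lambda>M. (M, unit_frame M)) ` ?X"
      by (force simp: intertwiners_def split_beta)
  qed
  have "closedin (top_of_set (?X \<times> ?T)) ((\<lambda>M. (M, unit_frame M)) ` ?X)"
    unfolding graph by (rule closedin_closed_Int[OF C])
  moreover have "unit_frame \<in> ?X \<rightarrow> ?T"
    using unit_frame by auto
  ultimately show ?thesis
    by (simp add: continuous_closed_graph_eq[OF compact_sphere])
qed

text \<open>
  Going from frames to hypermatrices and back replaces a frame by its positive multiple of norm
  one. The oriented frames form a cone, so this is homotopic to the identity.
\<close>

lemma nondegenerate_homotopy_eqv_oriented_frames:
  "(nondegenerate_hypermatrices :: (real^'k^'m^2) set) homotopy_eqv
   (oriented_frames :: ((real^'k^'k) \<times> (real^'m^'m)) set)"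
proof -
  let ?X = "nondegenerate_hypermatrices :: (real^'k^'m^2) set"
  let ?Y = "oriented_frames :: ((real^'k^'k) \<times> (real^'m^'m)) set"
  have nz: "det (fst v) \<noteq> 0" "det (snd v) \<noteq> 0" if "v \<in> ?Y" for v
    using that by (auto simp: oriented_frames_def)
  have X: "std_orbit_map v \<in> ?X" if "v \<in> ?Y" for v
    using std_orbit_map_nondegenerate[OF card nz[OF that]] by simp
  have contY: "continuous_on ?Y std_orbit_map"
    unfolding std_orbit_map_def split_beta using nz
    by (intro continuous_intros continuous_on_vec_lambda continuous_on_matrix_inv) auto
  have gf: "std_orbit_map (unit_frame M) = M" if "M \<in> ?X" for M
    using unit_frame[OF that] nz std_orbit_map_eq_iff[of "fst (unit_frame M)" "snd (unit_frame M)" M] by simp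
  have v: "v = norm v *\<^sub>R unit_frame (std_orbit_map v)" if "v \<in> ?Y" for v
  proof (rule unit_frame_unique[OF X[OF that]])
    show "v \<in> intertwiners (std_orbit_map v $ 1) (std_orbit_map v $ 2)"
      using std_orbit_map_eq_iff[OF nz(1)[OF that], of "snd v" "std_orbit_map v"] by simp
    show "v \<noteq> 0"
      using nz(1)[OF that] by (auto simp: det_zero_matrix)
    show "0 \<le> orientation v"
      using that by (simp add: oriented_frames_def)
  qed
  have "homotopic_with_canon (\<lambda>_. True) ?Y ?Y (unit_frame \<circ> std_orbit_map) id"
  proof (rule homotopic_with_linear)
    show "continuous_on ?Y (unit_frame \<circ> std_orbit_map)"
      using X by (intro continuous_on_compose contY continuous_on_subset[OF continuous_on_unit_frame]) auto
    fix v assume vY: "v \<in> ?Y"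
    let ?u = "unit_frame (std_orbit_map v)"
    have u: "?u \<in> ?Y"
      by (rule unit_frame(3)[OF X[OF vY]])
    show "closed_segment ((unit_frame \<circ> std_orbit_map) v) (id v) \<subseteq> ?Y"
    proof
      fix w assume "w \<in> closed_segment ((unit_frame \<circ> std_orbit_map) v) (id v)"
      then obtain t where t: "0 \<le> t" "t \<le> 1" "w = (1 - t) *\<^sub>R ?u + t *\<^sub>R v"
        by (auto simp: closed_segment_def)
      have "w = (1 - t) *\<^sub>R ?u + t *\<^sub>R (norm v *\<^sub>R ?u)"
        using t(3) v[OF vY] by metis
      also have "\<dots> = (1 - t + t * norm v) *\<^sub>R ?u"
        by (simp add: algebra_simps)
      finally have w: "w = (1 - t + t * norm v) *\<^sub>R ?u" .
      have "0 < norm v"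
        using nz(1)[OF vY] by (auto simp: det_zero_matrix)
      then have "0 < 1 - t + t * norm v"
        using t by (cases "t = 0") (auto intro: add_nonneg_pos)
      with u show "w \<in> ?Y"
        unfolding w by (rule oriented_frames_scaleR)
    qed
  qed auto
  moreover have "homotopic_with_canon (\<lambda>_. True) ?X ?X (std_orbit_map \<circ> unit_frame) id"
    by (rule homotopic_with_equal) (use gf continuous_on_unit_frame unit_frame(3) contY in
        \<open>auto intro!: continuous_map_compose simp: gf\<close>)
  ultimately show ?thesis
    unfolding homotopy_equivalent_space_def
    using contY continuous_on_unit_frame X unit_frame(3)
    by (intro exI[of _ unit_frame] exI[of _ std_orbit_map]) auto
qed

end

section \<open>Gram-Schmidt orthonormalisation\<close>

text \<open>
  Since \<open>sgn\<close> normalises vectors, this is the usual orthonormalisation of a sequence.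
\<close>

fun gram_schmidt :: "(nat \<Rightarrow> 'a::real_inner) \<Rightarrow> nat \<Rightarrow> 'a" where
  "gram_schmidt a n =
     sgn (a n - (\<Sum>i<n. (a n \<bullet> gram_schmidt a i) *\<^sub>R gram_schmidt a i))"

declare gram_schmidt.simps [simp del]

definition gs_residue :: "(nat \<Rightarrow> 'a::real_inner) \<Rightarrow> nat \<Rightarrow> 'a" where
  "gs_residue a n = a n - (\<Sum>i<n. (a n \<bullet> gram_schmidt a i) *\<^sub>R gram_schmidt a i)"

lemma gram_schmidt_sgn: "gram_schmidt a n = sgn (gs_residue a n)"
  by (simp add: gram_schmidt.simps[of a n] gs_residue_def)

lemma gram_schmidt_in_span: "gram_schmidt a n \<in> span (a ` {..n})"
proof (induction n rule: less_induct)
  case (less n)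
  have "gram_schmidt a i \<in> span (a ` {..n})" if "i < n" for i
    using less[OF that] span_mono[OF image_mono, of "{..i}" "{..n}" a] that by auto
  then show ?case
    unfolding gram_schmidt_sgn[of a n] gs_residue_def[of a n] sgn_div_norm
    by (intro span_scale span_diff span_sum) (simp_all add: span_base)
qed

lemma gs_residue_nonzero:
  assumes "a n \<notin> span (a ` {..<n})"
  shows "gs_residue a n \<noteq> 0"
proof
  assume "gs_residue a n = 0"
  then have "a n = (\<Sum>i<n. (a n \<bullet> gram_schmidt a i) *\<^sub>R gram_schmidt a i)"
    by (simp add: gs_residue_def)
  also have "\<dots> \<in> span (a ` {..<n})"
  proof (intro span_sum span_scale)
    fix i assume "i \<in> {..<n}"
    then have "{..i} \<subseteq> {..<n}" by auto
    then show "gram_schmidt a i \<in> span (a ` {..<n})"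
      using gram_schmidt_in_span[of a i] span_mono[OF image_mono, of "{..i}" "{..<n}" a] by auto
  qed
  finally show False using assms by simp
qed

lemma gram_schmidt_orthonormal:
  assumes "\<forall>i<N. a i \<notin> span (a ` {..<i})"
    and "i < N" "j < N"
  shows "gram_schmidt a i \<bullet> gram_schmidt a j = (if i = j then 1 else 0)"
proof -
  have "\<forall>i<n. \<forall>j<n. gram_schmidt a i \<bullet> gram_schmidt a j = (if i = j then 1 else 0)" if "n \<le> N" for n
    using that
  proof (induction n)
    case (Suc n)
    have IH: "gram_schmidt a i \<bullet> gram_schmidt a j = (if i = j then 1 else 0)" if "i < n" "j < n" for i j
      using Suc that by auto
    have "gs_residue a n \<bullet> gram_schmidt a j = 0" if "j < n" for j
    proof -
      have "(\<Sum>i<n. (a n \<bullet> gram_schmidt a i) *\<^sub>R gram_schmidt a i) \<bullet> gram_schmidt a j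
          = (\<Sum>i<n. (a n \<bullet> gram_schmidt a i) * (if i = j then 1 else 0))"
        unfolding inner_sum_left using that by (intro sum.cong) (auto simp: IH)
      then show ?thesis
        using that by (simp add: gs_residue_def inner_diff_left if_distrib cong: if_cong)
    qed
    then have 1: "gram_schmidt a n \<bullet> gram_schmidt a j = 0" if "j < n" for j
      using that unfolding gram_schmidt_sgn[of a n] by (simp add: sgn_div_norm)
    have "gs_residue a n \<noteq> 0"
      using Suc.prems assms(1) by (intro gs_residue_nonzero) simp
    then have "gram_schmidt a n \<bullet> gram_schmidt a n = 1"
      by (simp add: gram_schmidt_sgn dot_square_norm norm_sgn)
    with 1 IH show ?case
      by (auto simp: less_Suc_eq inner_commute)
  qed simp
  then show ?thesis using assms(2,3) by blast
qed

text \<open>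
  Expanding \<open>a i\<close> in the orthonormal vectors involves only those up to \<open>i\<close>, and the coefficient of
  the last one is the norm of the residue.
\<close>

lemma gram_schmidt_triangular:
  assumes indep: "\<forall>i<N. a i \<notin> span (a ` {..<i})"
  shows "i < j \<Longrightarrow> j < N \<Longrightarrow> a i \<bullet> gram_schmidt a j = 0"
    and "j < N \<Longrightarrow> 0 < a j \<bullet> gram_schmidt a j"
proof -
  have *: "a i \<bullet> gram_schmidt a j = (if i = j then norm (gs_residue a i) else 0)"
    if "i \<le> j" "j < N" for i j
  proof -
    have "a i = norm (gs_residue a i) *\<^sub>R gram_schmidt a i
        + (\<Sum>l<i. (a i \<bullet> gram_schmidt a l) *\<^sub>R gram_schmidt a l)"
      using gs_residue_nonzero[of a i] indep that
      by (simp add: gram_schmidt_sgn[of a i] sgn_div_norm) (simp add: gs_residue_def)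
    then have "a i \<bullet> gram_schmidt a j = (norm (gs_residue a i) *\<^sub>R gram_schmidt a i
        + (\<Sum>l<i. (a i \<bullet> gram_schmidt a l) *\<^sub>R gram_schmidt a l)) \<bullet> gram_schmidt a j"
      by (rule arg_cong)
    also have "\<dots> = norm (gs_residue a i) * (gram_schmidt a i \<bullet> gram_schmidt a j)
        + (\<Sum>l<i. (a i \<bullet> gram_schmidt a l) * (gram_schmidt a l \<bullet> gram_schmidt a j))"
      by (simp add: inner_add_left inner_sum_left)
    also have "(\<Sum>l<i. (a i \<bullet> gram_schmidt a l) * (gram_schmidt a l \<bullet> gram_schmidt a j)) = 0"
      using that gram_schmidt_orthonormal[OF indep] by (intro sum.neutral) auto
    finally show ?thesis
      using that gram_schmidt_orthonormal[OF indep, of i j] by simp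
  qed
  show "i < j \<Longrightarrow> j < N \<Longrightarrow> a i \<bullet> gram_schmidt a j = 0"
    using *[of i j] by simp
  show "j < N \<Longrightarrow> 0 < a j \<bullet> gram_schmidt a j"
    using *[of j j] gs_residue_nonzero[of a j] indep by simp
qed

lemma gram_schmidt_orthonormal_id:
  assumes "\<And>i j. i < N \<Longrightarrow> j < N \<Longrightarrow> a i \<bullet> a j = (if i = j then 1 else 0)"
  shows "n < N \<Longrightarrow> gram_schmidt a n = a n"
proof (induction n rule: less_induct)
  case (less n)
  have "gs_residue a n = a n"
    using less assms[of n] unfolding gs_residue_def by (simp add: sum.neutral)
  moreover have "norm (a n) = 1"
    using assms[of n n] less.prems by (simp add: norm_eq_1)
  ultimately show ?case
    by (simp add: gram_schmidt_sgn sgn_div_norm)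
qed

definition orthonormalise :: "real^'n^'n \<Rightarrow> real^'n^'n" where
  "orthonormalise A = (\<chi> i j. gram_schmidt (ncol A) (idx j) $ i)"

lemma column_orthonormalise: "column j (orthonormalise A) = gram_schmidt (ncol A) (idx j)"
  by (simp add: orthonormalise_def column_def vec_eq_iff)

lemma mult_axis_column: "A *v axis j 1 = column j (A::real^'n^'m)"
  by (simp add: vec_eq_iff matrix_vector_mult_axis column_def)

lemma invertible_columns_independent:
  fixes A :: "real^'n^'n"
  assumes "det A \<noteq> 0"
  shows "\<forall>i<CARD('n). ncol A i \<notin> span (ncol A ` {..<i})"
proof (intro allI impI notI)
  fix i assume i: "i < CARD('n)"
  let ?V = "{x :: real^'n. \<forall>n. i \<le> idx n \<longrightarrow> x $ n = 0}"
  have "subspace ?V"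
    by (auto simp: subspace_def)
  then have sub: "subspace ((*v) A ` ?V)"
    by (intro linear_subspace_image matrix_vector_mul_linear)
  assume "ncol A i \<in> span (ncol A ` {..<i})"
  also have "span (ncol A ` {..<i}) \<subseteq> (*v) A ` ?V"
  proof (intro span_minimal sub image_subsetI)
    fix n assume "n \<in> {..<i}"
    then have "axis (unidx n) 1 \<in> ?V"
      using i by (auto simp: axis_def)
    then show "ncol A n \<in> (*v) A ` ?V"
      unfolding mult_axis_column[symmetric] by blast
  qed
  finally obtain x where x: "x \<in> ?V" "A *v axis (unidx i) 1 = A *v x"
    by (auto simp: mult_axis_column)
  then have "A *v (axis (unidx i) 1 - x) = 0"
    by (simp add: matrix_vector_mult_diff_distrib)
  then have "x = axis (unidx i) 1"
    using assms(1) unfolding det_nonzero_iff_kernel by force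
  then have "x $ unidx i = 1"
    by simp
  then show False
    using x(1) i by auto
qed

lemma orthogonal_orthonormalise:
  fixes A :: "real^'n^'n"
  assumes "det A \<noteq> 0"
  shows "orthogonal_matrix (orthonormalise A)"
proof -
  have "gram_schmidt (ncol A) (idx i) \<bullet> gram_schmidt (ncol A) (idx j) = (if i = j then 1 else 0)" for i j :: 'n
    using gram_schmidt_orthonormal[OF invertible_columns_independent[OF assms] idx_less idx_less] by simp
  then show ?thesis
    by (simp add: orthogonal_matrix_orthonormal_columns column_orthonormalise norm_eq_1 orthogonal_def)
qed

lemma orthonormalise_orthogonal:
  fixes A :: "real^'n^'n"
  assumes "orthogonal_matrix A"
  shows "orthonormalise A = A"
proof -
  have "column i A \<bullet> column j A = (if i = j then 1 else 0)" for i j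
    using assms by (auto simp: orthogonal_matrix_orthonormal_columns orthogonal_def norm_eq_1)
  then have "gram_schmidt (ncol A) n = ncol A n" if "n < CARD('n)" for n
    using that by (intro gram_schmidt_orthonormal_id) (auto dest: arg_cong[where f=idx])
  then show ?thesis
    by (simp add: matrix_eq_columns column_orthonormalise idx_less)
qed

lemma continuous_on_column:
  fixes f :: "'a::topological_space \<Rightarrow> real^'n^'m"
  assumes "continuous_on S f"
  shows "continuous_on S (\<lambda>x. column j (f x))"
  unfolding column_def using assms by (intro continuous_intros continuous_on_vec_lambda)

lemma continuous_on_orthonormalise:
  "continuous_on {A :: real^'n^'n. det A \<noteq> 0} orthonormalise"
proof -
  let ?S = "{A :: real^'n^'n. det A \<noteq> 0}"
  have gs: "continuous_on ?S (\<lambda>A. gram_schmidt (ncol A) n)" if "n < CARD('n)" for n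
    using that
  proof (induction n rule: less_induct)
    case (less n)
    show ?case
      unfolding gram_schmidt_sgn
    proof (rule continuous_on_sgn)
      show "continuous_on ?S (\<lambda>A. gs_residue (ncol A) n)"
        unfolding gs_residue_def using less
        by (intro continuous_intros continuous_on_column) auto
      show "\<forall>A\<in>?S. gs_residue (ncol A) n \<noteq> 0"
      proof
        fix A :: "real^'n^'n" assume "A \<in> ?S"
        then show "gs_residue (ncol A) n \<noteq> 0"
          using invertible_columns_independent[of A] less.prems by (intro gs_residue_nonzero) simp
      qed
    qed
  qed
  show ?thesis
    unfolding orthonormalise_def
    by (intro continuous_on_vec_lambda continuous_on_component gs idx_less)
qed

text \<open>
  With respect to the orthonormal basis, all matrices of the segment are upper triangular with positive
  diagonal.
\<close>

lemma det_segment_orthonormalise_nonzero: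
  fixes A :: "real^'n^'n"
  assumes A: "det A \<noteq> 0" and t: "0 \<le> t" "t \<le> 1"
  shows "det ((1 - t) *\<^sub>R A + t *\<^sub>R orthonormalise A) \<noteq> 0"
proof -
  let ?a = "ncol A" and ?g = "gram_schmidt (ncol A)" and ?B = "(1 - t) *\<^sub>R A + t *\<^sub>R orthonormalise A"
  have col: "ncol ?B n = (1 - t) *\<^sub>R ?a n + t *\<^sub>R ?g n" if "n < CARD('n)" for n
    using column_orthonormalise[of "unidx n" A] that by (simp add: column_def vec_eq_iff)
  note tri = gram_schmidt_triangular[OF invertible_columns_independent[OF A]]
  note ortho = gram_schmidt_orthonormal[OF invertible_columns_independent[OF A]]
  have upper: "ncol ?B i \<bullet> ?g j = 0" if "i < j" "j < CARD('n)" for i j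
    using tri(1)[OF that] ortho[of i j] that by (simp add: col inner_add_left)
  have diag: "0 < ncol ?B j \<bullet> ?g j" if "j < CARD('n)" for j
  proof (cases "t = 1")
    case True
    with ortho[OF that that] col[OF that] show ?thesis by simp
  next
    case False
    then have "0 < (1 - t) * (?a j \<bullet> ?g j)"
      using tri(2)[OF that] t by simp
    then show ?thesis
      using ortho[OF that that] col[OF that] t by (simp add: inner_add_left)
  qed
  have "x = 0" if x: "?B *v x = 0" for x
  proof -
    \<comment> \<open>Back substitution, starting from the last coordinate.\<close>
    have coords: "x $ unidx (CARD('n) - Suc m) = 0" if "m < CARD('n)" for m
      using that
    proof (induction m rule: less_induct)
      case (less m)
      let ?j = "CARD('n) - Suc m"
      have j: "?j < CARD('n)" using less.prems by simp
      have later: "x $ unidx i = 0" if "?j < i" "i < CARD('n)" for i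
      proof -
        have "CARD('n) - Suc i < m" "CARD('n) - Suc (CARD('n) - Suc i) = i"
          using that less.prems by auto
        then show ?thesis
          using less.IH[of "CARD('n) - Suc i"] less.prems by simp
      qed
      have "0 = (\<Sum>n<CARD('n). x $ unidx n * (ncol ?B n \<bullet> ?g ?j))"
        using arg_cong[OF x, of "\<lambda>v. v \<bullet> ?g ?j"]
        unfolding matrix_vector_mult_ncol inner_sum_left inner_scaleR_left by simp
      also have "\<dots> = x $ unidx ?j * (ncol ?B ?j \<bullet> ?g ?j) +
          (\<Sum>n\<in>{..<CARD('n)} - {?j}. x $ unidx n * (ncol ?B n \<bullet> ?g ?j))"
        using j by (intro sum.remove) auto
      also have "(\<Sum>n\<in>{..<CARD('n)} - {?j}. x $ unidx n * (ncol ?B n \<bullet> ?g ?j)) = 0"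
      proof (intro sum.neutral ballI)
        fix n assume "n \<in> {..<CARD('n)} - {?j}"
        then show "x $ unidx n * (ncol ?B n \<bullet> ?g ?j) = 0"
          using upper[OF _ j, of n] later[of n] by (cases "n < ?j") auto
      qed
      finally show ?case
        using diag[OF j] by simp
    qed
    have "x $ unidx n = 0" if "n < CARD('n)" for n
    proof -
      have "CARD('n) - Suc (CARD('n) - Suc n) = n"
        using that by simp
      then show ?thesis
        using coords[of "CARD('n) - Suc n"] by simp
    qed
    then show ?thesis
      by (simp add: vec_eq_iff forall_idx)
  qed
  then show ?thesis
    by (simp add: det_nonzero_iff_kernel)
qed

text \<open>
  A change of sign along the segment would force a zero of the determinant.
\<close>

lemma det_segment_orthonormalise:
  fixes A :: "real^'n^'n"
  assumes A: "det A \<noteq> 0" and t: "0 \<le> t" "t \<le> 1"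
  shows "0 < det A * det ((1 - t) *\<^sub>R A + t *\<^sub>R orthonormalise A)"
proof (rule ccontr)
  let ?d = "\<lambda>s. det A * det ((1 - s) *\<^sub>R A + s *\<^sub>R orthonormalise A)"
  assume "\<not> 0 < ?d t"
  moreover have "continuous_on {0..t} ?d"
    by (intro continuous_intros)
  moreover have "0 \<le> ?d 0"
    by simp
  ultimately obtain s where "0 \<le> s" "s \<le> t" "?d s = 0"
    using IVT2'[of ?d t 0 0] t by auto
  then show False
    using det_segment_orthonormalise_nonzero[OF A, of s] A t by simp
qed

section \<open>Retraction onto orthogonal frames and the two components\<close>

definition orthogonal_frames :: "((real^'k^'k) \<times> (real^'m^'m)) set" where
  "orthogonal_frames =
     {v \<in> oriented_frames. orthogonal_matrix (fst v) \<and> orthogonal_matrix (snd v)}"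

lemma oriented_frames_homotopy_eqv_orthogonal_frames:
  "(oriented_frames :: ((real^'k^'k) \<times> (real^'m^'m)) set) homotopy_eqv
   (orthogonal_frames :: ((real^'k^'k) \<times> (real^'m^'m)) set)"
proof -
  let ?Y = "oriented_frames :: ((real^'k^'k) \<times> (real^'m^'m)) set"
  let ?Z = "orthogonal_frames :: ((real^'k^'k) \<times> (real^'m^'m)) set"
  let ?r = "\<lambda>v :: (real^'k^'k) \<times> (real^'m^'m). (orthonormalise (fst v), orthonormalise (snd v))"
  have nz: "det (fst v) \<noteq> 0" "det (snd v) \<noteq> 0" if "v \<in> ?Y" for v
    using that by (auto simp: oriented_frames_def)
  have seg: "(1 - t) *\<^sub>R v + t *\<^sub>R ?r v \<in> ?Y" if v: "v \<in> ?Y" and t: "0 \<le> t" "t \<le> 1" for v t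
    using v det_segment_orthonormalise[OF nz(1)[OF v] t] det_segment_orthonormalise[OF nz(2)[OF v] t]
    by (auto simp: oriented_frames_def orientation_def zero_less_mult_iff split: if_splits)
  have r: "?r v \<in> ?Z" if "v \<in> ?Y" for v
    using seg[OF that, of 1] nz[OF that] by (simp add: orthogonal_frames_def orthogonal_orthonormalise)
  have cont: "continuous_on ?Y ?r"
    by (intro continuous_intros continuous_on_compose2[OF continuous_on_orthonormalise])
      (auto simp: oriented_frames_def)
  have "homotopic_with_canon (\<lambda>_. True) ?Y ?Y id ?r"
  proof (rule homotopic_with_linear[OF _ cont])
    show "closed_segment (id v) (?r v) \<subseteq> ?Y" if "v \<in> ?Y" for v
      using seg[OF that] by (auto simp: closed_segment_def)
  qed auto
  then have "homotopic_with_canon (\<lambda>_. True) ?Y ?Y ?r id"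
    by (rule homotopic_with_symD)
  moreover have "retraction_maps (top_of_set ?Y) (top_of_set ?Z) ?r id"
    unfolding retraction_maps_def
  proof (intro conjI ballI)
    show "continuous_map (top_of_set ?Y) (top_of_set ?Z) ?r"
      using cont r by auto
    show "continuous_map (top_of_set ?Z) (top_of_set ?Y) id"
      by (auto simp: orthogonal_frames_def)
    fix v assume "v \<in> topspace (top_of_set ?Z)"
    then show "?r (id v) = v"
      by (simp add: orthogonal_frames_def orthonormalise_orthogonal)
  qed
  ultimately show ?thesis
    by (rule deformation_retract_imp_homotopy_equivalent_space)
qed

lemma homeomorphic_space_sum_topology_bool:
  assumes U: "openin X U" and V: "openin X V" and UV: "U \<inter> V = {}" "U \<union> V = topspace X"
    and TU: "T homeomorphic_space subtopology X U" and TV: "T homeomorphic_space subtopology X V"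
  shows "X homeomorphic_space sum_topology (\<lambda>_. T) (UNIV :: bool set)"
proof -
  obtain f where f: "homeomorphic_map T (subtopology X U) f"
    using TU homeomorphic_space by blast
  obtain g where g: "homeomorphic_map T (subtopology X V) g"
    using TV homeomorphic_space by blast
  have sub: "topspace (subtopology X U) = U" "topspace (subtopology X V) = V"
    using UV by auto
  have fim: "f ` topspace T = U" and gim: "g ` topspace T = V"
    using homeomorphic_imp_surjective_map[OF f] homeomorphic_imp_surjective_map[OF g] sub by auto
  have inj: "inj_on f (topspace T)" "inj_on g (topspace T)"
    using f g homeomorphic_imp_injective_map by blast+
  have cont: "continuous_map T X f" "continuous_map T X g"
    using f g by (meson homeomorphic_imp_continuous_map continuous_map_into_fulltopology)+
  have op: "openin X (f ` W)" "openin X (g ` W)" if "openin T W" for W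
    using that f g U V homeomorphic_imp_open_map unfolding open_map_def
    by (meson openin_trans_full)+
  let ?h = "\<lambda>(b, x). if b then f x else g x"
  have "homeomorphic_map (sum_topology (\<lambda>_. T) (UNIV :: bool set)) X ?h"
  proof (rule bijective_open_imp_homeomorphic_map)
    show "continuous_map (sum_topology (\<lambda>_. T) UNIV) X ?h"
      unfolding continuous_map_def
    proof (intro conjI allI impI)
      show "?h \<in> topspace (sum_topology (\<lambda>_. T) UNIV) \<rightarrow> topspace X"
        using cont by (auto simp: continuous_map_def Pi_iff)
      fix W assume W: "openin X W"
      have "openin T {x. (b, x) \<in> {y \<in> topspace (sum_topology (\<lambda>_. T) UNIV). ?h y \<in> W}}" for b
        using openin_continuous_map_preimage[OF cont(1) W] openin_continuous_map_preimage[OF cont(2) W]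
        by (cases b) auto
      then show "openin (sum_topology (\<lambda>_. T) UNIV) {y \<in> topspace (sum_topology (\<lambda>_. T) UNIV). ?h y \<in> W}"
        unfolding openin_sum_topology by auto
    qed
    show "open_map (sum_topology (\<lambda>_. T) UNIV) X ?h"
      unfolding open_map_def
    proof (intro allI impI)
      fix W assume "openin (sum_topology (\<lambda>_. T) (UNIV :: bool set)) W"
      then have "openin T {x. (b, x) \<in> W}" for b
        by (auto simp: openin_sum_topology)
      then have "openin X (f ` {x. (True, x) \<in> W} \<union> g ` {x. (False, x) \<in> W})"
        by (intro openin_Un op)
      also have "f ` {x. (True, x) \<in> W} \<union> g ` {x. (False, x) \<in> W} = ?h ` W"
        by (force simp: image_iff split: if_splits)
      finally show "openin X (?h ` W)" .
    qed
    show "?h ` topspace (sum_topology (\<lambda>_. T) UNIV) = topspace X"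
    proof -
      have "topspace (sum_topology (\<lambda>_. T) (UNIV :: bool set))
          = Pair True ` topspace T \<union> Pair False ` topspace T"
        by (auto simp: UNIV_bool)
      then have "?h ` topspace (sum_topology (\<lambda>_. T) UNIV) = f ` topspace T \<union> g ` topspace T"
        by (simp add: image_Un image_image)
      then show ?thesis
        using fim gim UV by simp
    qed
    show "inj_on ?h (topspace (sum_topology (\<lambda>_. T) UNIV))"
    proof (rule inj_onI)
      fix p q
      assume p: "p \<in> topspace (sum_topology (\<lambda>_. T) (UNIV :: bool set))"
        and q: "q \<in> topspace (sum_topology (\<lambda>_. T) (UNIV :: bool set))" and pq: "?h p = ?h q"
      obtain a x b y where ab: "p = (a, x)" "q = (b, y)"
        by (cases p, cases q) blast
      with p q have xy: "x \<in> topspace T" "y \<in> topspace T" by auto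
      then have "f x \<in> U" "f y \<in> U" "g x \<in> V" "g y \<in> V"
        using fim gim by auto
      then have "a = b"
        using pq UV(1) unfolding ab by (cases a; cases b) auto
      moreover have "x = y"
        using pq xy inj \<open>a = b\<close> unfolding ab by (cases b) (auto dest: inj_onD)
      ultimately show "p = q"
        by (simp add: ab)
    qed
  qed
  then show ?thesis
    using homeomorphic_map_imp_homeomorphic_space homeomorphic_space_sym by blast
qed

lemma reflection_exists:
  obtains J :: "real^'n^'n" where "orthogonal_matrix J" "det J = -1" "J ** J = mat 1"
proof -
  obtain a :: 'n where True by blast
  define J :: "real^'n^'n" where "J = (\<chi> i j. if i = j then (if i = a then -1 else 1) else 0)"
  have "det J = (\<Prod>i\<in>UNIV. J $ i $ i)"
    by (rule det_diagonal) (simp add: J_def)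
  also have "\<dots> = -1"
    by (simp add: J_def prod.If_cases)
  finally have "det J = -1" .
  moreover have JJ: "J ** J = mat 1"
    by (simp add: J_def matrix_matrix_mult_def mat_def vec_eq_iff if_distrib[where f="\<lambda>x. x * _"]
        cong: if_cong)
  moreover have "orthogonal_matrix J"
  proof -
    have "transpose J = J"
      by (simp add: J_def transpose_def vec_eq_iff)
    with JJ show ?thesis by (simp add: orthogonal_matrix)
  qed
  ultimately show ?thesis using that by blast
qed

lemma orthogonal_frames_iff:
  "v \<in> orthogonal_frames \<longleftrightarrow>
     orthogonal_matrix (fst v) \<and> orthogonal_matrix (snd v) \<and> orientation v = 1"
  using det_orthogonal_matrix[of "fst v"] det_orthogonal_matrix[of "snd v"]
  by (auto simp: orthogonal_frames_def oriented_frames_def orientation_def)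

text \<open>
  The even-sized matrix of an orthogonal frame has determinant \<open>1\<close> or \<open>-1\<close>. Multiplication of that
  matrix by a reflection exchanges the two open parts.
\<close>

lemma orthogonal_frames_homeomorphic_sum:
  "top_of_set (orthogonal_frames :: ((real^'k^'k) \<times> (real^'m^'m)) set) homeomorphic_space
   sum_topology (\<lambda>_. prod_topology (top_of_set (special_orthogonal :: (real^'k^'k) set))
       (top_of_set (special_orthogonal :: (real^'m^'m) set))) (UNIV :: bool set)"
proof -
  let ?Z = "orthogonal_frames :: ((real^'k^'k) \<times> (real^'m^'m)) set"
  let ?d = "\<lambda>v :: (real^'k^'k) \<times> (real^'m^'m). det (fst v) * det (snd v)"
  let ?U = "{v \<in> ?Z. 0 < ?d v}" and ?V = "{v \<in> ?Z. ?d v < 0}"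
  let ?S = "(special_orthogonal :: (real^'k^'k) set) \<times> (special_orthogonal :: (real^'m^'m) set)"
  obtain R1 :: "real^'k^'k" where R1: "orthogonal_matrix R1" "det R1 = -1" "R1 ** R1 = mat 1"
    by (rule reflection_exists)
  obtain R2 :: "real^'m^'m" where R2: "orthogonal_matrix R2" "det R2 = -1" "R2 ** R2 = mat 1"
    by (rule reflection_exists)
  define J1 where "J1 = (if odd CARD('k) then mat 1 else R1)"
  define J2 where "J2 = (if odd CARD('k) then R2 else mat 1)"
  have J: "orthogonal_matrix J1" "orthogonal_matrix J2" "J1 ** J1 = mat 1" "J2 ** J2 = mat 1"
    using R1 R2 by (auto simp: J1_def J2_def orthogonal_matrix_id)
  have dJ: "det J1 = (if odd CARD('k) then 1 else -1)" "det J2 = (if odd CARD('k) then -1 else 1)"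
    using R1 R2 by (auto simp: J1_def J2_def)
  define \<phi> where "\<phi> = (\<lambda>v :: (real^'k^'k) \<times> (real^'m^'m). (fst v ** J1, snd v ** J2))"
  have pm: "det Q = 1 \<or> det Q = -1" if "orthogonal_matrix Q" for Q :: "real^'n^'n"
    using that by (rule det_orthogonal_matrix)
  have "v \<in> ?U \<longleftrightarrow> v \<in> ?S" for v
    using pm[of "fst v"] pm[of "snd v"]
    by (cases v) (auto simp: orthogonal_frames_iff orientation_def special_orthogonal_def rotation_matrix_def)
  then have U: "?U = ?S" by blast
  have \<phi>\<phi>: "\<phi> (\<phi> v) = v" for v
    using J by (simp add: \<phi>_def matrix_mul_assoc[symmetric])
  have V: "v \<in> ?V \<longleftrightarrow> \<phi> v \<in> ?S" for v
  proof -
    have "orthogonal_matrix (fst (\<phi> v)) \<and> orthogonal_matrix (snd (\<phi> v))"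
      if "orthogonal_matrix (fst v) \<and> orthogonal_matrix (snd v)" for v
      using that J(1,2) by (simp add: \<phi>_def orthogonal_matrix_mul)
    from this[of v] this[of "\<phi> v"]
    have "orthogonal_matrix (fst v) \<and> orthogonal_matrix (snd v) \<longleftrightarrow>
        orthogonal_matrix (fst (\<phi> v)) \<and> orthogonal_matrix (snd (\<phi> v))"
      unfolding \<phi>\<phi> by blast
    moreover have "det (fst (\<phi> v)) = det (fst v) * det J1" "det (snd (\<phi> v)) = det (snd v) * det J2"
      by (simp_all add: \<phi>_def det_mul)
    ultimately show ?thesis
      using pm[of "fst v"] pm[of "snd v"]
      by (cases "\<phi> v") (auto simp: orthogonal_frames_iff orientation_def special_orthogonal_def
          rotation_matrix_def dJ)
  qed
  have cont: "continuous_on A \<phi>" for A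
    unfolding \<phi>_def by (intro continuous_intros)
  have "homeomorphic_maps (top_of_set ?S) (top_of_set ?V) \<phi> \<phi>"
  proof -
    have "\<phi> \<in> ?S \<rightarrow> ?V" "\<phi> \<in> ?V \<rightarrow> ?S"
      using V \<phi>\<phi> by (metis (no_types, lifting) Pi_I)+
    then show ?thesis
      unfolding homeomorphic_maps_def continuous_map_subtopology_eu
      by (intro conjI ballI cont \<phi>\<phi>) auto
  qed
  then have SV: "top_of_set ?S homeomorphic_space top_of_set ?V"
    unfolding homeomorphic_space_def by blast
  have "top_of_set ?Z homeomorphic_space sum_topology (\<lambda>_. top_of_set ?S) (UNIV :: bool set)"
  proof (rule homeomorphic_space_sum_topology_bool[of _ ?U ?V])
    have op: "open {v. 0 < ?d v}" "open {v. ?d v < 0}"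
      by (intro open_Collect_less continuous_intros)+
    have eq: "?U = ?Z \<inter> {v. 0 < ?d v}" "?V = ?Z \<inter> {v. ?d v < 0}" by auto
    show "openin (top_of_set ?Z) ?U" "openin (top_of_set ?Z) ?V"
      unfolding eq using op by (auto intro: openin_open_Int)
    show "?U \<inter> ?V = {}" by auto
    show "?U \<union> ?V = topspace (top_of_set ?Z)"
      by (auto simp: orthogonal_frames_def oriented_frames_def mult_less_0_iff zero_less_mult_iff)
    have *: "subtopology (top_of_set ?Z) {v \<in> ?Z. P v} = top_of_set {v \<in> ?Z. P v}" for P
      by (simp add: subtopology_subtopology Int_absorb1 Collect_subset)
    show "top_of_set ?S homeomorphic_space subtopology (top_of_set ?Z) ?U"
      unfolding * unfolding U by (rule homeomorphic_space_refl)
    show "top_of_set ?S homeomorphic_space subtopology (top_of_set ?Z) ?V"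
      unfolding * by (rule SV)
  qed
  then show ?thesis by simp
qed

theorem corollary3p4:
  fixes k :: nat
  assumes "k \<ge> 1" and "CARD('k::finite) = k" and "CARD('m::finite) = k + 1"
  shows "top_of_set (nondegenerate_hypermatrices :: (real^'k^'m^2) set)
           homotopy_equivalent_space
         sum_topology
           (\<lambda>_. prod_topology (top_of_set (special_orthogonal :: (real^'k^'k) set))
                              (top_of_set (special_orthogonal :: (real^'m^'m) set)))
           (UNIV :: bool set)"
proof -
  have "(nondegenerate_hypermatrices :: (real^'k^'m^2) set) homotopy_eqv
      (oriented_frames :: ((real^'k^'k) \<times> (real^'m^'m)) set)"
    using assms by (intro nondegenerate_homotopy_eqv_oriented_frames) simp
  also note oriented_frames_homotopy_eqv_orthogonal_frames
  also note homeomorphic_imp_homotopy_equivalent_space[OF orthogonal_frames_homeomorphic_sum]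
  finally show ?thesis .
qed

end
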